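(* Let $M$ and $V$ be finite-dimensional vector spaces. A complete set of invariants for the weak equivalence group action on systems $(E,A)$ with domain $M$ and codomain $V$ is given by the three integers $$d:=\dim V'',\qquad a:=\dim\ker[E]=\alpha_1,\qquad s:=\dim(V'/V'').$$ That is, two systems with domain $M$ and codomain $V$ lie in the same orbit of the action if and only if they have the same integers $d$, $a$ and $s$.
   Context: Fix a field $\mathbb K$; all spaces are over $\mathbb K$. A system $(E,A)$ with domain $M$ and codomain $V$ is a pair of linear maps $E,A:M\to V$. Put $V'=EM$, $M'=A^{-1}V'=\{x\in M:Ax\in V'\}$, $V''=EM'\subset V'$. Let $[E]:M/M'\to V'/V''$ be the map induced by $E$ on the quotients; $\alpha_1:=\dim\ker[E]$. The weak equivalence group consists of triples $(P,Q,R)$ with $P$ an automorphism of $V$, $Q$ an automorphism of $M$ and $R$ an arbitrary endomorphism of $M$, with product $(P_2,Q_2,R_2)\cdot(P_1,Q_1,R_1)=(P_2P_1,\,Q_1Q_2,\,Q_1R_2+R_1Q_2)$. It acts on systems by $$(P,Q,R)\cdot(E,A):=(PEQ,\;P(ER+AQ)).$$ *)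

theory Defs
  imports
    "HOL-Algebra.AbelCoset"
    "HOL-Algebra.Group_Action"
    "Jordan_Normal_Form.Missing_VectorSpace"
begin

section \<open>Linear maps, quotient spaces and induced maps\<close>

text \<open>
  Vector spaces are carrier-based (locale \<^locale>\<open>vectorspace\<close>). Linear maps are taken to be
  extensional, so that equality in HOL is equality of maps on the carrier; without this, pairs of
  maps differing only outside the carriers would count as different systems.
\<close>

definition lin_maps ::
  "('k, 'c) ring_scheme \<Rightarrow> ('k, 'm, 'd) module_scheme \<Rightarrow> ('k, 'v, 'e) module_scheme \<Rightarrow> ('m \<Rightarrow> 'v) set"
  where "lin_maps K M V = module_hom K M V \<inter> extensional (carrier M)"

definition lin_autos :: "('k, 'c) ring_scheme \<Rightarrow> ('k, 'v, 'e) module_scheme \<Rightarrow> ('v \<Rightarrow> 'v) set"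
  where "lin_autos K V = module_hom K V V \<inter> Bij (carrier V)"

text \<open>
  The quotient \<open>V / W\<close>, with the cosets of \<open>W\<close> as elements. The ring multiplication and unit
  of the record type \<^typ>\<open>('k, 'v) module\<close> play no role for modules.
\<close>

definition quotient_space :: "('k, 'v, 'e) module_scheme \<Rightarrow> 'v set \<Rightarrow> ('k, 'v set) module"
  where "quotient_space V W =
    \<lparr>carrier = a_rcosets\<^bsub>V\<^esub> W,
     mult = undefined,
     one = undefined,
     zero = W,
     add = (\<lambda>X Y. X <+>\<^bsub>V\<^esub> Y),
     smult = (\<lambda>c X. \<Union>x\<in>X. W +>\<^bsub>V\<^esub> (c \<odot>\<^bsub>V\<^esub> x))\<rparr>"

text \<open>
  The map \<open>x + W \<mapsto> f x + U\<close> into a quotient of (a subspace of) \<open>V\<close> by \<open>U\<close>. The union runs over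
  all representatives of the coset; when \<open>f\<close> maps \<open>W\<close> into \<open>U\<close>, they all contribute the same coset.
\<close>

definition induced_map :: "('k, 'v, 'e) module_scheme \<Rightarrow> 'v set \<Rightarrow> ('m \<Rightarrow> 'v) \<Rightarrow> 'm set \<Rightarrow> 'v set"
  where "induced_map V U f X = (\<Union>x\<in>X. U +>\<^bsub>V\<^esub> f x)"


section \<open>Systems and their invariants\<close>

definition systems ::
  "('k, 'c) ring_scheme \<Rightarrow> ('k, 'm, 'd) module_scheme \<Rightarrow> ('k, 'v, 'e) module_scheme
    \<Rightarrow> (('m \<Rightarrow> 'v) \<times> ('m \<Rightarrow> 'v)) set"
  where "systems K M V = lin_maps K M V \<times> lin_maps K M V"

text \<open>The subspaces \<open>V' = EM\<close>, \<open>M' = A\<^sup>-\<^sup>1 V'\<close> and \<open>V'' = EM'\<close>.\<close>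

definition codom1 :: "('k, 'm, 'd) module_scheme \<Rightarrow> ('m \<Rightarrow> 'v) \<Rightarrow> 'v set"
  where "codom1 M E = E ` carrier M"

definition dom1 :: "('k, 'm, 'd) module_scheme \<Rightarrow> ('m \<Rightarrow> 'v) \<Rightarrow> ('m \<Rightarrow> 'v) \<Rightarrow> 'm set"
  where "dom1 M E A = {x \<in> carrier M. A x \<in> codom1 M E}"

definition codom2 :: "('k, 'm, 'd) module_scheme \<Rightarrow> ('m \<Rightarrow> 'v) \<Rightarrow> ('m \<Rightarrow> 'v) \<Rightarrow> 'v set"
  where "codom2 M E A = E ` dom1 M E A"

definition dom_quotient ::
  "('k, 'm, 'd) module_scheme \<Rightarrow> ('m \<Rightarrow> 'v) \<Rightarrow> ('m \<Rightarrow> 'v) \<Rightarrow> ('k, 'm set) module"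
  where "dom_quotient M E A = quotient_space M (dom1 M E A)"

definition codom_quotient ::
  "('k, 'm, 'd) module_scheme \<Rightarrow> ('k, 'v, 'e) module_scheme \<Rightarrow> ('m \<Rightarrow> 'v) \<Rightarrow> ('m \<Rightarrow> 'v)
    \<Rightarrow> ('k, 'v set) module"
  where "codom_quotient M V E A = quotient_space (V\<lparr>carrier := codom1 M E\<rparr>) (codom2 M E A)"

text \<open>The kernel of the map \<open>[E] : M/M' \<rightarrow> V'/V''\<close>.\<close>

definition ker_induced ::
  "('k, 'm, 'd) module_scheme \<Rightarrow> ('k, 'v, 'e) module_scheme \<Rightarrow> ('m \<Rightarrow> 'v) \<Rightarrow> ('m \<Rightarrow> 'v) \<Rightarrow> 'm set set"
  where "ker_induced M V E A =
    mod_hom.ker (dom_quotient M E A) (codom_quotient M V E A) (induced_map V (codom2 M E A) E)"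

definition inv_d ::
  "('k, 'c) ring_scheme \<Rightarrow> ('k, 'm, 'd) module_scheme \<Rightarrow> ('k, 'v, 'e) module_scheme
    \<Rightarrow> ('m \<Rightarrow> 'v) \<Rightarrow> ('m \<Rightarrow> 'v) \<Rightarrow> nat"
  where "inv_d K M V E A = vectorspace.dim K (V\<lparr>carrier := codom2 M E A\<rparr>)"

definition inv_a ::
  "('k, 'c) ring_scheme \<Rightarrow> ('k, 'm, 'd) module_scheme \<Rightarrow> ('k, 'v, 'e) module_scheme
    \<Rightarrow> ('m \<Rightarrow> 'v) \<Rightarrow> ('m \<Rightarrow> 'v) \<Rightarrow> nat"
  where "inv_a K M V E A = vectorspace.dim K ((dom_quotient M E A)\<lparr>carrier := ker_induced M V E A\<rparr>)"

definition inv_s ::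
  "('k, 'c) ring_scheme \<Rightarrow> ('k, 'm, 'd) module_scheme \<Rightarrow> ('k, 'v, 'e) module_scheme
    \<Rightarrow> ('m \<Rightarrow> 'v) \<Rightarrow> ('m \<Rightarrow> 'v) \<Rightarrow> nat"
  where "inv_s K M V E A = vectorspace.dim K (codom_quotient M V E A)"


section \<open>The weak equivalence group and its action\<close>

definition weak_group ::
  "('k, 'c) ring_scheme \<Rightarrow> ('k, 'm, 'd) module_scheme \<Rightarrow> ('k, 'v, 'e) module_scheme
    \<Rightarrow> (('v \<Rightarrow> 'v) \<times> ('m \<Rightarrow> 'm) \<times> ('m \<Rightarrow> 'm)) monoid"
  where "weak_group K M V =
    \<lparr>carrier = lin_autos K V \<times> lin_autos K M \<times> lin_maps K M M,
     mult = (\<lambda>(P2, Q2, R2) (P1, Q1, R1).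
       (compose (carrier V) P2 P1,
        compose (carrier M) Q1 Q2,
        \<lambda>x\<in>carrier M. Q1 (R2 x) \<oplus>\<^bsub>M\<^esub> R1 (Q2 x))),
     one = (\<lambda>y\<in>carrier V. y, \<lambda>x\<in>carrier M. x, \<lambda>x\<in>carrier M. \<zero>\<^bsub>M\<^esub>)\<rparr>"

text \<open>
  The outer restriction to \<open>systems K M V\<close> is the convention of \<^locale>\<open>group_action\<close>, whose
  group elements act by extensional bijections.
\<close>

definition weak_action ::
  "('k, 'c) ring_scheme \<Rightarrow> ('k, 'm, 'd) module_scheme \<Rightarrow> ('k, 'v, 'e) module_scheme
    \<Rightarrow> ('v \<Rightarrow> 'v) \<times> ('m \<Rightarrow> 'm) \<times> ('m \<Rightarrow> 'm)
    \<Rightarrow> ('m \<Rightarrow> 'v) \<times> ('m \<Rightarrow> 'v) \<Rightarrow> ('m \<Rightarrow> 'v) \<times> ('m \<Rightarrow> 'v)"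
  where "weak_action K M V = (\<lambda>(P, Q, R). \<lambda>(E, A)\<in>systems K M V.
    (\<lambda>x\<in>carrier M. P (E (Q x)),
     \<lambda>x\<in>carrier M. P (E (R x) \<oplus>\<^bsub>V\<^esub> A (Q x))))"

end

theory Submission
  imports Defs
begin

text \<open>
  Write \<open>N = ker E\<close> and \<open>M' = A\<^sup>-\<^sup>1(EM)\<close>. By rank-nullity the three integers amount to the dimensions
  of \<open>N\<close>, \<open>M'\<close> and \<open>N \<inter> M'\<close>:
  \<open>d + dim (N \<inter> M') = dim M'\<close>, \<open>a + dim (N \<inter> M') = dim N\<close> and \<open>s + d + dim N = dim M\<close>.
  They are invariant because the component \<open>Q\<close> of a group element maps the pair \<open>(N, M')\<close> of the
  transformed system onto that of the original one.

  Conversely, adding a suitable \<open>ER\<close> to \<open>A\<close> gives \<open>B\<close> with \<open>B M \<inter> E M = 0\<close> and \<open>ker B = M'\<close>. If the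
  dimensions agree, an automorphism \<open>Q\<close> of \<open>M\<close> matches the pairs of subspaces of two such systems.
  Then \<open>(x, y) \<mapsto> E Q x + B Q y\<close> and \<open>(x, y) \<mapsto> E' x + B' y\<close> are maps \<open>M \<oplus> M \<rightarrow> V\<close> with the same
  kernel, hence they differ by an automorphism \<open>P\<close> of \<open>V\<close>.
\<close>

section \<open>Linear maps and bases\<close>

lemma linear_mapI:
  assumes "vectorspace K V" "vectorspace K W" "T \<in> module_hom K V W"
  shows "linear_map K V W T"
  using assms unfolding linear_map_def mod_hom_def mod_hom_axioms_def vectorspace_def by blast

lemma module_homI:
  assumes "\<And>x. x \<in> carrier M \<Longrightarrow> f x \<in> carrier N"
    and "\<And>x y. x \<in> carrier M \<Longrightarrow> y \<in> carrier M \<Longrightarrow> f (x \<oplus>\<^bsub>M\<^esub> y) = f x \<oplus>\<^bsub>N\<^esub> f y"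
    and "\<And>r x. r \<in> carrier R \<Longrightarrow> x \<in> carrier M \<Longrightarrow> f (r \<odot>\<^bsub>M\<^esub> x) = r \<odot>\<^bsub>N\<^esub> f x"
  shows "f \<in> module_hom R M N"
  using assms unfolding module_hom_def by blast

lemma module_hom_comp:
  assumes "f \<in> module_hom R L M" "g \<in> module_hom R M N"
  shows "(\<lambda>x. g (f x)) \<in> module_hom R L N"
  using assms unfolding module_hom_def Pi_def by auto

lemma module_hom_cong:
  assumes "module R M" and "f \<in> module_hom R M N"
    and "\<And>x. x \<in> carrier M \<Longrightarrow> g x = f x"
  shows "g \<in> module_hom R M N"
proof -
  interpret M: module R M by fact
  show ?thesis
    using assms(2,3) unfolding module_hom_def Pi_def by simp
qed

lemma module_hom_add_maps:
  assumes "module R M" "module R N" "f \<in> module_hom R M N" "g \<in> module_hom R M N"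
  shows "(\<lambda>x. f x \<oplus>\<^bsub>N\<^esub> g x) \<in> module_hom R M N"
proof -
  interpret N: module R N by fact
  show ?thesis
    using assms(3,4) unfolding module_hom_def Pi_def
    by (auto simp: N.smult_r_distr N.a_ac)
qed

lemma module_hom_neg:
  assumes "module R M" "module R N" "f \<in> module_hom R M N"
  shows "(\<lambda>x. \<ominus>\<^bsub>N\<^esub> f x) \<in> module_hom R M N"
proof -
  interpret N: module R N by fact
  show ?thesis
    using assms(3) unfolding module_hom_def Pi_def
    by (auto simp: N.smult_r_minus N.minus_add)
qed

context vectorspace
begin

section \<open>Subspaces, bases inside them, and maps given on a basis\<close>

lemma subspaceI:
  assumes "U \<subseteq> carrier V" "\<zero>\<^bsub>V\<^esub> \<in> U"
    and "\<And>u v. u \<in> U \<Longrightarrow> v \<in> U \<Longrightarrow> u \<oplus>\<^bsub>V\<^esub> v \<in> U"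
    and "\<And>c u. c \<in> carrier K \<Longrightarrow> u \<in> U \<Longrightarrow> c \<odot>\<^bsub>V\<^esub> u \<in> U"
  shows "subspace K U V"
  using assms vectorspace_axioms module_axioms
  unfolding subspace_def submodule_def by blast

lemma subspaceD:
  assumes "subspace K U V"
  shows "U \<subseteq> carrier V" "\<zero>\<^bsub>V\<^esub> \<in> U"
    and "\<And>u v. u \<in> U \<Longrightarrow> v \<in> U \<Longrightarrow> u \<oplus>\<^bsub>V\<^esub> v \<in> U"
    and "\<And>c u. c \<in> carrier K \<Longrightarrow> u \<in> U \<Longrightarrow> c \<odot>\<^bsub>V\<^esub> u \<in> U"
    and "\<And>u. u \<in> U \<Longrightarrow> \<ominus>\<^bsub>V\<^esub> u \<in> U"
    and "\<And>u v. u \<in> U \<Longrightarrow> v \<in> U \<Longrightarrow> u \<ominus>\<^bsub>V\<^esub> v \<in> U"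
proof -
  have s: "submodule K U V" using assms unfolding subspace_def by blast
  show sub: "U \<subseteq> carrier V" and "\<zero>\<^bsub>V\<^esub> \<in> U"
    and add: "\<And>u v. u \<in> U \<Longrightarrow> v \<in> U \<Longrightarrow> u \<oplus>\<^bsub>V\<^esub> v \<in> U"
    and smult: "\<And>c u. c \<in> carrier K \<Longrightarrow> u \<in> U \<Longrightarrow> c \<odot>\<^bsub>V\<^esub> u \<in> U"
    using s unfolding submodule_def by blast+
  show neg: "\<ominus>\<^bsub>V\<^esub> u \<in> U" if "u \<in> U" for u
  proof -
    have "(\<ominus>\<^bsub>K\<^esub> \<one>\<^bsub>K\<^esub>) \<odot>\<^bsub>V\<^esub> u \<in> U" using smult that by simp
    then show ?thesis using smult_minus_1 that sub by auto
  qed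
  show "\<And>u v. u \<in> U \<Longrightarrow> v \<in> U \<Longrightarrow> u \<ominus>\<^bsub>V\<^esub> v \<in> U"
    unfolding a_minus_def using add neg by blast
qed

lemma subspace_carrier: "subspace K (carrier V) V"
  by (rule subspaceI) auto

lemma subspace_Int:
  assumes "subspace K U V" "subspace K W V"
  shows "subspace K (U \<inter> W) V"
  by (rule subspaceI) (use subspaceD[OF assms(1)] subspaceD[OF assms(2)] in auto)

lemma span_subset_subspace:
  assumes "subspace K U V" "S \<subseteq> U"
  shows "span S \<subseteq> U"
  using span_is_subset[OF assms(2)] assms(1) by simp

text \<open>Independent sets between \<open>A\<close> and \<open>U\<close> have at most
  \<open>dim\<close> elements, so a maximal one exists. A vector of \<open>U\<close> outside its
  span could be adjoined, against maximality. Span and independence are those of the ambient space,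
  which lets bases of different subspaces be compared and united.\<close>

lemma extend_basis_subspace:
  assumes fd: fin_dim and U: "subspace K U V" and A: "A \<subseteq> U" "lin_indpt A"
  obtains B where "A \<subseteq> B" "B \<subseteq> U" "finite B" "lin_indpt B" "span B = U"
proof -
  let ?P = "\<lambda>S. A \<subseteq> S \<and> S \<subseteq> U \<and> lin_indpt S"
  have UV: "U \<subseteq> carrier V" using subspaceD(1)[OF U] .
  have "\<exists>B. finite B \<and> maximal B ?P"
    by (rule maximal_exists[where N = dim and B = A]) (use A UV li_le_dim[OF fd] in auto)
  then obtain B where B: "finite B" "maximal B ?P" by blast
  then have BP: "A \<subseteq> B" "B \<subseteq> U" "lin_indpt B"
    and max: "\<And>C. B \<subseteq> C \<Longrightarrow> ?P C \<Longrightarrow> C = B"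
    unfolding maximal_def by auto
  have BV: "B \<subseteq> carrier V" using BP UV by auto
  have "U \<subseteq> span B"
  proof
    fix v assume v: "v \<in> U"
    show "v \<in> span B"
    proof (rule ccontr)
      assume n: "v \<notin> span B"
      then have vB: "v \<notin> B" using in_own_span[OF BV] by auto
      then have "lin_indpt (B \<union> {v})"
        using lin_dep_iff_in_span[OF BV BP(3) _ vB] n v UV by auto
      then have "B \<union> {v} = B" using max[of "B \<union> {v}"] BP v by auto
      then show False using vB by auto
    qed
  qed
  then have "span B = U" using span_subset_subspace[OF U BP(2)] by auto
  then show ?thesis using that B BP by blast
qed

lemma extend_basis:
  assumes fin_dim "A \<subseteq> carrier V" "lin_indpt A"
  obtains B where "A \<subseteq> B" "finite B" "basis B"
  using extend_basis_subspace[OF assms(1) subspace_carrier assms(2,3)]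
  unfolding basis_def by metis

lemma lin_indpt_empty: "lin_indpt {}"
  unfolding lin_dep_def by auto

lemma subspace_basis:
  assumes fin_dim "subspace K U V"
  obtains B where "B \<subseteq> U" "finite B" "lin_indpt B" "span B = U"
  using extend_basis_subspace[OF assms _ lin_indpt_empty] by blast

text \<open>Span and independence of a subset of \<open>U\<close> are the same in \<open>U\<close>
  as in the ambient space, so a basis found in the latter measures \<open>U\<close>.\<close>

lemma dim_subspace_card:
  assumes U: "subspace K U V" and "finite B" "lin_indpt B" and B: "span B = U" "B \<subseteq> U"
  shows "vectorspace.dim K (vs U) = card B"
proof -
  interpret U: vectorspace K "vs U" using subspace_is_vs[OF U] .
  have sub: "submodule K U V" using U by simp
  have "U.basis B"
    unfolding U.basis_def using span_li_not_depend[OF B(2) sub] assms by simp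
  then show ?thesis using U.dim_basis assms by blast
qed

lemma fin_dim_subspace:
  assumes fin_dim and U: "subspace K U V"
  shows "vectorspace.fin_dim K (vs U)"
proof -
  interpret U: vectorspace K "vs U" using subspace_is_vs[OF U] .
  have sub: "submodule K U V" using U by simp
  obtain B where B: "B \<subseteq> U" "finite B" "lin_indpt B" "span B = U"
    using subspace_basis assms by blast
  then show ?thesis
    unfolding U.fin_dim_def using span_li_not_depend[OF B(1) sub] by auto
qed

text \<open>The image of \<open>v\<close> is the combination of the values \<open>f b\<close> with
  the coordinates of \<open>v\<close>. Linearity follows because coordinates are unique.\<close>

lemma linear_extension:
  assumes fin: "finite B" and B: "basis B" and W: "vectorspace K W" and f: "f \<in> B \<rightarrow> carrier W"
  obtains T where "T \<in> module_hom K V W" "\<And>b. b \<in> B \<Longrightarrow> T b = f b"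
proof -
  interpret W: vectorspace K W by fact
  have BV: "B \<subseteq> carrier V" using B unfolding basis_def by blast
  \<comment> \<open>Coordinates are unique only up to their values outside \<open>B\<close>. Taking
    them extensional on \<open>B\<close> makes the description definite.\<close>
  define c where "c v = (THE a. a \<in> B \<rightarrow>\<^sub>E carrier K \<and> lincomb a B = v)" for v
  have ex1: "\<exists>!a. a \<in> B \<rightarrow>\<^sub>E carrier K \<and> lincomb a B = v" if "v \<in> carrier V" for v
    using basis_criterion[OF fin BV] B that by blast
  have c: "c v \<in> B \<rightarrow>\<^sub>E carrier K" "lincomb (c v) B = v" if "v \<in> carrier V" for v
    using theI'[OF ex1[OF that]] unfolding c_def by auto
  have cK: "c v b \<in> carrier K" if "v \<in> carrier V" "b \<in> B" for v b
    using c(1)[OF that(1)] that(2) by auto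
  have cf: "c v b \<odot>\<^bsub>W\<^esub> f b \<in> carrier W" if "v \<in> carrier V" "b \<in> B" for v b
    using cK[OF that] f that by auto
  \<comment> \<open>Any coefficients that represent \<open>v\<close> agree with \<open>c v\<close>
    on \<open>B\<close>. This is what computes the coordinates of sums, of scalar multiples and of
    basis vectors below.\<close>
  have c_eq: "c v b = a b" if a: "a \<in> B \<rightarrow> carrier K" "lincomb a B = v" and b: "b \<in> B" for v a b
  proof -
    have v: "v \<in> carrier V" using a BV by auto
    have "lincomb (restrict a B) B = lincomb a B"
      by (rule lincomb_cong) (use a BV in auto)
    then have "c v = restrict a B"
      using ex1[OF v] c[OF v] a by (metis restrict_PiE_iff Pi_iff)
    then show ?thesis using b by simp
  qed
  define T where "T v = (\<Oplus>\<^bsub>W\<^esub>b\<in>B. c v b \<odot>\<^bsub>W\<^esub> f b)" for v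
  have "T \<in> module_hom K V W"
  proof (rule module_homI)
    show "T x \<in> carrier W" if "x \<in> carrier V" for x
      unfolding T_def using cf[OF that] by (intro W.finsum_closed) auto
  next
    fix x y assume x: "x \<in> carrier V" and y: "y \<in> carrier V"
    have e: "c (x \<oplus>\<^bsub>V\<^esub> y) b = c x b \<oplus>\<^bsub>K\<^esub> c y b" if "b \<in> B" for b
      using that cK x y c(2)
      by (intro c_eq[of "\<lambda>b. c x b \<oplus>\<^bsub>K\<^esub> c y b"]) (auto simp: lincomb_sum[OF fin BV])
    have "T (x \<oplus>\<^bsub>V\<^esub> y) = (\<Oplus>\<^bsub>W\<^esub>b\<in>B. c x b \<odot>\<^bsub>W\<^esub> f b \<oplus>\<^bsub>W\<^esub> c y b \<odot>\<^bsub>W\<^esub> f b)"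
      unfolding T_def
      by (rule W.finsum_cong') (use e f cK x y cf in \<open>auto simp: W.smult_l_distr Pi_iff\<close>)
    also have "\<dots> = T x \<oplus>\<^bsub>W\<^esub> T y"
      unfolding T_def by (rule W.finsum_addf) (use cf x y in auto)
    finally show "T (x \<oplus>\<^bsub>V\<^esub> y) = T x \<oplus>\<^bsub>W\<^esub> T y" .
  next
    fix r x assume r: "r \<in> carrier K" and x: "x \<in> carrier V"
    have e: "c (r \<odot>\<^bsub>V\<^esub> x) b = r \<otimes>\<^bsub>K\<^esub> c x b" if "b \<in> B" for b
      using that cK r x c(2)
      by (intro c_eq[of "\<lambda>b. r \<otimes>\<^bsub>K\<^esub> c x b"]) (auto simp: lincomb_smult[OF BV])
    have "T (r \<odot>\<^bsub>V\<^esub> x) = (\<Oplus>\<^bsub>W\<^esub>b\<in>B. r \<odot>\<^bsub>W\<^esub> (c x b \<odot>\<^bsub>W\<^esub> f b))"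
      unfolding T_def
      by (rule W.finsum_cong') (use e f cK r x cf in \<open>auto simp: W.smult_assoc1 Pi_iff\<close>)
    also have "\<dots> = r \<odot>\<^bsub>W\<^esub> T x"
      unfolding T_def by (rule W.finsum_smult[symmetric]) (use cf x r fin in auto)
    finally show "T (r \<odot>\<^bsub>V\<^esub> x) = r \<odot>\<^bsub>W\<^esub> T x" .
  qed
  moreover have "T b = f b" if b: "b \<in> B" for b
  proof -
    \<comment> \<open>A basis vector has Kronecker delta coordinates, and only one term of the sum
      survives.\<close>
    have "lincomb (\<lambda>a. if b = a then \<one>\<^bsub>K\<^esub> else \<zero>\<^bsub>K\<^esub>) B
        = (\<Oplus>\<^bsub>V\<^esub>a\<in>B. if b = a then a else \<zero>\<^bsub>V\<^esub>)"
      unfolding lincomb_def by (rule finsum_cong') (use BV in auto)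
    also have "\<dots> = b"
      by (rule add.finprod_singleton) (use b fin BV in auto)
    finally have "c b a = (if b = a then \<one>\<^bsub>K\<^esub> else \<zero>\<^bsub>K\<^esub>)" if "a \<in> B" for a
      using that by (intro c_eq[of "\<lambda>a. if b = a then \<one>\<^bsub>K\<^esub> else \<zero>\<^bsub>K\<^esub>"]) auto
    then have "T b = (\<Oplus>\<^bsub>W\<^esub>a\<in>B. if b = a then f a else \<zero>\<^bsub>W\<^esub>)"
      unfolding T_def by (intro W.finsum_cong') (use f in \<open>auto simp: Pi_iff\<close>)
    also have "\<dots> = f b"
      by (rule W.add.finprod_singleton) (use b fin f in auto)
    finally show ?thesis .
  qed
  ultimately show ?thesis using that by blast
qed

lemma vimage_subspace:
  assumes W: "vectorspace K W" and T: "T \<in> module_hom K V W" and U: "subspace K U W"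
  shows "subspace K {v \<in> carrier V. T v \<in> U} V"
proof -
  interpret W: vectorspace K W by fact
  interpret linear_map K V W T using linear_mapI vectorspace_axioms W T by blast
  show ?thesis
    by (rule subspaceI) (use W.subspaceD[OF U] in auto)
qed

lemma image_subspace:
  assumes W: "vectorspace K W" and T: "T \<in> module_hom K V W" and U: "subspace K U V"
  shows "subspace K (T ` U) W"
proof -
  interpret W: vectorspace K W by fact
  interpret linear_map K V W T using linear_mapI vectorspace_axioms W T by blast
  note D = subspaceD[OF U]
  show ?thesis
  proof (rule W.subspaceI)
    show "T ` U \<subseteq> carrier W" using D(1) by auto
    show "\<zero>\<^bsub>W\<^esub> \<in> T ` U" using D(2) by (metis f0_is_0 imageI)
    show "u \<oplus>\<^bsub>W\<^esub> v \<in> T ` U" if uv: "u \<in> T ` U" "v \<in> T ` U" for u v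
    proof -
      obtain x y where xy: "x \<in> U" "y \<in> U" "u = T x" "v = T y" using uv by blast
      then have "u \<oplus>\<^bsub>W\<^esub> v = T (x \<oplus>\<^bsub>V\<^esub> y)"
        using f_add[OF subsetD[OF D(1) xy(1)] subsetD[OF D(1) xy(2)]] by simp
      then show ?thesis using D(3) xy by blast
    qed
    show "c \<odot>\<^bsub>W\<^esub> u \<in> T ` U" if cu: "c \<in> carrier K" "u \<in> T ` U" for c u
    proof -
      obtain x where x: "x \<in> U" "u = T x" using cu by blast
      then have "c \<odot>\<^bsub>W\<^esub> u = T (c \<odot>\<^bsub>V\<^esub> x)"
        using f_smult[OF cu(1) subsetD[OF D(1) x(1)]] by simp
      then show ?thesis using D(4) x cu by blast
    qed
  qed
qed

text \<open>The vectors on which \<open>S\<close> and \<open>T\<close> agree form a subspace, and it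
  contains \<open>B\<close>.\<close>

lemma hom_eq_on_span:
  assumes W: "vectorspace K W" and T: "S \<in> module_hom K V W" "T \<in> module_hom K V W"
    and B: "B \<subseteq> carrier V" "\<And>b. b \<in> B \<Longrightarrow> S b = T b" and v: "v \<in> span B"
  shows "S v = T v"
proof -
  interpret S: linear_map K V W S using linear_mapI vectorspace_axioms W T by blast
  interpret T: linear_map K V W T using linear_mapI vectorspace_axioms W T by blast
  have "subspace K {v \<in> carrier V. S v = T v} V"
    by (rule subspaceI) auto
  then have "span B \<subseteq> {v \<in> carrier V. S v = T v}"
    by (rule span_subset_subspace) (use B in auto)
  then show ?thesis using v by auto
qed

text \<open>Extend \<open>f\<close> and its inverse linearly. Both composites fix a basis, hence are
  the identity.\<close>

lemma automorphism_of_bases: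
  assumes "finite B" "basis B" "finite C" "basis C" and f: "bij_betw f B C"
  obtains P where "P \<in> lin_autos K V" "\<And>b. b \<in> B \<Longrightarrow> P b = f b"
proof -
  have BC: "B \<subseteq> carrier V" "span B = carrier V" "C \<subseteq> carrier V" "span C = carrier V"
    using assms unfolding basis_def by blast+
  have fC: "f \<in> B \<rightarrow> carrier V"
    using bij_betw_apply[OF f] BC(3) by blast
  have gB: "inv_into B f \<in> C \<rightarrow> carrier V"
    using bij_betw_apply[OF bij_betw_inv_into[OF f]] BC(1) by blast
  obtain S where S: "S \<in> module_hom K V V" "\<And>b. b \<in> B \<Longrightarrow> S b = f b"
    using linear_extension[OF assms(1,2) vectorspace_axioms fC] by metis
  obtain T where T: "T \<in> module_hom K V V" "\<And>b. b \<in> C \<Longrightarrow> T b = inv_into B f b"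
    using linear_extension[OF assms(3,4) vectorspace_axioms gB] by metis
  have id: "(\<lambda>x. x) \<in> module_hom K V V" unfolding module_hom_def by auto
  have TS: "T (S v) = v" if "v \<in> carrier V" for v
  proof (rule hom_eq_on_span[OF vectorspace_axioms module_hom_comp[OF S(1) T(1)] id BC(1)])
    show "T (S b) = b" if b: "b \<in> B" for b
      using S(2)[OF b] T(2)[OF bij_betw_apply[OF f b]] bij_betw_inv_into_left[OF f b] by metis
    show "v \<in> span B" using that BC(2) by metis
  qed
  have ST: "S (T v) = v" if "v \<in> carrier V" for v
  proof (rule hom_eq_on_span[OF vectorspace_axioms module_hom_comp[OF T(1) S(1)] id BC(3)])
    show "S (T c) = c" if c: "c \<in> C" for c
      using T(2)[OF c] S(2)[OF bij_betw_apply[OF bij_betw_inv_into[OF f] c]]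
        bij_betw_inv_into_right[OF f c] by metis
    show "v \<in> span C" using that BC(4) by metis
  qed
  have bij: "bij_betw S (carrier V) (carrier V)"
    by (rule bij_betwI[OF module_hom_closed[OF S(1)] module_hom_closed[OF T(1)] TS ST])
  \<comment> \<open>The linear extension has arbitrary values outside the carrier, whereas members
    of \<open>Bij\<close> are extensional.\<close>
  let ?P = "restrict S (carrier V)"
  have "?P \<in> module_hom K V V"
    by (rule module_hom_cong[OF module_axioms S(1)]) simp
  moreover have "?P \<in> Bij (carrier V)"
    using bij_betw_cong[of "carrier V" ?P S "carrier V"] bij unfolding Bij_def by simp
  ultimately have "?P \<in> lin_autos K V" unfolding lin_autos_def by (rule IntI)
  then show ?thesis
  proof (rule that)
    show "?P b = f b" if b: "b \<in> B" for b
      using S(2)[OF b] subsetD[OF BC(1) b] by simp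
  qed
qed

end

section \<open>Automorphisms with prescribed behaviour on subspaces\<close>

text \<open>Bijections between corresponding fibres are glued together. Later \<open>p\<close> and
  \<open>q\<close> record to which of two subspaces a basis vector belongs.\<close>

lemma bij_betw_of_card_fibres:
  assumes "finite A" "finite B"
    and card: "\<And>c. card {x \<in> A. p x = c} = card {y \<in> B. q y = c}"
  obtains f where "bij_betw f A B" "\<And>x. x \<in> A \<Longrightarrow> q (f x) = p x"
proof -
  have "\<exists>h. bij_betw h {x \<in> A. p x = c} {y \<in> B. q y = c}" for c
    by (rule finite_same_card_bij) (use assms in auto)
  then obtain h where h: "\<And>c. bij_betw (h c) {x \<in> A. p x = c} {y \<in> B. q y = c}"
    by metis
  define f where "f x = h (p x) x" for x
  have f: "f x \<in> B" "q (f x) = p x" if "x \<in> A" for x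
    using bij_betw_apply[OF h, of x "p x"] that unfolding f_def by auto
  have "inj_on f A"
  proof (rule inj_onI)
    fix x y assume xy: "x \<in> A" "y \<in> A" "f x = f y"
    then have "p x = p y" using f(2) by metis
    then show "x = y"
      using xy bij_betw_imp_inj_on[OF h[of "p x"]] unfolding f_def inj_on_def by auto
  qed
  moreover have "B \<subseteq> f ` A"
  proof
    fix y assume "y \<in> B"
    then have "y \<in> h (q y) ` {x \<in> A. p x = q y}"
      using bij_betw_imp_surj_on[OF h[of "q y"]] by auto
    then obtain x where x: "x \<in> A" "p x = q y" "y = h (q y) x" by blast
    then have "y = f x" unfolding f_def by simp
    then show "y \<in> f ` A" using x(1) by blast
  qed
  ultimately have "bij_betw f A B" unfolding bij_betw_def using f(1) by auto
  then show ?thesis using that f(2) by metis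
qed

lemma lin_autosD:
  assumes "Q \<in> lin_autos K V"
  shows "Q \<in> module_hom K V V" "inj_on Q (carrier V)" "Q ` carrier V = carrier V"
    "\<And>x. x \<in> carrier V \<Longrightarrow> Q x \<in> carrier V"
  using assms unfolding lin_autos_def Bij_def bij_betw_def by auto

context vectorspace
begin

lemma module_hom_subspace:
  assumes "subspace K U V" "f \<in> module_hom K V W"
  shows "f \<in> module_hom K (vs U) W"
  by (rule module_homI)
    (use subsetD[OF subspaceD(1)[OF assms(1)]] assms(2) in \<open>simp_all add: module_hom_def Pi_iff\<close>)

text \<open>A linear relation on the union equates a vector of \<open>span S\<close> with one of
  \<open>span T\<close>. Both are then zero, and the two parts of the relation are trivial
  separately.\<close>

lemma lin_indpt_UnI:
  assumes fin: "finite S" "finite T" and sub: "S \<subseteq> carrier V" "T \<subseteq> carrier V"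
    and li: "lin_indpt S" "lin_indpt T" and int: "span S \<inter> span T \<subseteq> {\<zero>\<^bsub>V\<^esub>}"
  shows "lin_indpt (S \<union> T)"
proof (rule finite_lin_indpt2)
  show "finite (S \<union> T)" "S \<union> T \<subseteq> carrier V" using assms by auto
  \<comment> \<open>A common element would lie in both spans and so be zero, but an independent set
    does not contain zero.\<close>
  have disj: "S \<inter> T = {}"
    using in_own_span[OF sub(1)] in_own_span[OF sub(2)] int vs_zero_lin_dep[OF sub(1) li(1)] by blast
  fix a assume a: "a \<in> S \<union> T \<rightarrow> carrier K" and 0: "lincomb a (S \<union> T) = \<zero>\<^bsub>V\<^esub>"
  have aST: "a \<in> S \<rightarrow> carrier K" "a \<in> T \<rightarrow> carrier K" using a by auto
  have s: "lincomb a S \<in> span S" "lincomb a T \<in> span T"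
    unfolding span_def using fin aST by blast+
  have car: "lincomb a S \<in> carrier V" "lincomb a T \<in> carrier V" using aST sub by auto
  have sum: "lincomb a S \<oplus>\<^bsub>V\<^esub> lincomb a T = \<zero>\<^bsub>V\<^esub>"
    using lincomb_union[OF sub disj fin a] 0 by simp
  then have "lincomb a S = \<ominus>\<^bsub>V\<^esub> lincomb a T" using minus_equality car by metis
  then have "lincomb a S \<in> span T" using span_neg[OF sub(2) s(2)] by simp
  then have S0: "lincomb a S = \<zero>\<^bsub>V\<^esub>" using s(1) int by auto
  then have T0: "lincomb a T = \<zero>\<^bsub>V\<^esub>" using sum car by simp
  show "\<forall>v\<in>S \<union> T. a v = \<zero>\<^bsub>K\<^esub>"
    using not_lindepD[OF li(1) fin(1) subset_refl aST(1) S0]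
      not_lindepD[OF li(2) fin(2) subset_refl aST(2) T0] by auto
qed

text \<open>Two expansions of the same vector, one over \<open>S\<close> and one over
  \<open>T\<close>, subtract to a relation on the union.\<close>

lemma span_Int_of_lin_indpt:
  assumes fin: "finite S" "finite T" and sub: "S \<subseteq> carrier V" "T \<subseteq> carrier V"
    and disj: "S \<inter> T = {}" and li: "lin_indpt (S \<union> T)"
  shows "span S \<inter> span T \<subseteq> {\<zero>\<^bsub>V\<^esub>}"
proof
  fix x assume x: "x \<in> span S \<inter> span T"
  obtain a where a: "a \<in> S \<rightarrow> carrier K" "lincomb a S = x"
    using x finite_in_span[OF fin(1) sub(1)] by blast
  obtain b where b: "b \<in> T \<rightarrow> carrier K" "lincomb b T = x"
    using x finite_in_span[OF fin(2) sub(2)] by blast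
  have xV: "x \<in> carrier V" using a sub by auto
  \<comment> \<open>These are the coefficients of the difference of the two expansions. The sign is
    written as a scalar factor so that it can be taken out of the whole combination.\<close>
  define c where "c v = (if v \<in> S then a v else \<ominus>\<^bsub>K\<^esub> \<one>\<^bsub>K\<^esub> \<otimes>\<^bsub>K\<^esub> b v)" for v
  have c: "c \<in> S \<union> T \<rightarrow> carrier K" using a(1) b(1) unfolding c_def by (auto simp: Pi_iff)
  have 1: "lincomb c S = x"
    using a(2) by (subst a(2)[symmetric], intro lincomb_cong) (use a sub in \<open>auto simp: c_def\<close>)
  have "lincomb c T = lincomb (\<lambda>v. \<ominus>\<^bsub>K\<^esub> \<one>\<^bsub>K\<^esub> \<otimes>\<^bsub>K\<^esub> b v) T"
    by (intro lincomb_cong) (use b sub disj in \<open>auto simp: c_def\<close>)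
  also have "\<dots> = \<ominus>\<^bsub>V\<^esub> x"
    using lincomb_smult[OF sub(2) b(1)] b(2) smult_minus_1[OF xV] by simp
  finally have "lincomb c (S \<union> T) = \<zero>\<^bsub>V\<^esub>"
    using lincomb_union[OF sub disj fin c] 1 xV by (simp add: r_neg)
  then have "c \<in> S \<union> T \<rightarrow> {\<zero>\<^bsub>K\<^esub>}"
    using not_lindepD[OF li _ subset_refl c] fin by auto
  then have "a \<in> S \<rightarrow> {\<zero>\<^bsub>K\<^esub>}" unfolding c_def by (auto simp: Pi_iff split: if_splits)
  then show "x \<in> {\<zero>\<^bsub>V\<^esub>}" using lincomb_zero[OF sub(1)] a(2) by auto
qed

text \<open>A basis of the whole space may meet a subspace in too few vectors to span it. It
  suffices that it contains some spanning set of the subspace.\<close>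

lemma span_Int_eqI:
  assumes "subspace K U V" "C \<subseteq> B" "C \<subseteq> U" "span C = U"
  shows "span (B \<inter> U) = U"
proof
  show "span (B \<inter> U) \<subseteq> U" using span_subset_subspace[OF assms(1)] by blast
  show "U \<subseteq> span (B \<inter> U)" using span_is_monotone[of C "B \<inter> U"] assms by blast
qed

text \<open>A basis \<open>B0\<close> of the intersection is extended to a basis \<open>C\<close> of
  \<open>N\<close> and to a basis \<open>D\<close> of \<open>L\<close>. The union of
  \<open>C\<close> and \<open>D\<close> is still independent and extends to a basis of the whole
  space.\<close>

lemma adapted_basis:
  assumes fd: fin_dim and N: "subspace K N V" and L: "subspace K L V"
  obtains B where "finite B" "basis B" "span (B \<inter> N) = N" "span (B \<inter> L) = L"
    "span (B \<inter> (N \<inter> L)) = N \<inter> L"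
proof -
  note NL = subspace_Int[OF N L]
  obtain B0 where B0: "B0 \<subseteq> N \<inter> L" "finite B0" "lin_indpt B0" "span B0 = N \<inter> L"
    using subspace_basis[OF fd NL] by blast
  obtain C where C: "B0 \<subseteq> C" "C \<subseteq> N" "finite C" "lin_indpt C" "span C = N"
    using extend_basis_subspace[OF fd N _ B0(3)] B0(1) by blast
  obtain D where D: "B0 \<subseteq> D" "D \<subseteq> L" "finite D" "lin_indpt D" "span D = L"
    using extend_basis_subspace[OF fd L _ B0(3)] B0(1) by blast
  have car: "C \<subseteq> carrier V" "D \<subseteq> carrier V"
    using C(2) D(2) subspaceD(1)[OF N] subspaceD(1)[OF L] by blast+
  \<comment> \<open>Since \<open>C\<close> is independent, \<open>C - B0\<close> spans a complement
    of the intersection in \<open>N\<close>. A vector of it that also lies in \<open>L\<close> is in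
    \<open>span B0\<close>, hence zero.\<close>
  have "span (C - B0) \<inter> span B0 \<subseteq> {\<zero>\<^bsub>V\<^esub>}"
  proof (rule span_Int_of_lin_indpt)
    show "lin_indpt (C - B0 \<union> B0)" using C(1,4) by (simp add: Un_absorb2)
  qed (use C B0 car in auto)
  moreover have "span (C - B0) \<subseteq> N" using span_subset_subspace[OF N] C(2) by blast
  ultimately have "span (C - B0) \<inter> span D \<subseteq> {\<zero>\<^bsub>V\<^esub>}" using B0(4) D(5) by blast
  then have "lin_indpt (C - B0 \<union> D)"
    by (intro lin_indpt_UnI) (use C(3) D(3,4) car subset_li_is_li[OF C(4)] in auto)
  moreover have "C - B0 \<union> D = C \<union> D" using D(1) by blast
  ultimately have "lin_indpt (C \<union> D)" by simp
  then obtain B where B: "C \<union> D \<subseteq> B" "finite B" "basis B"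
    using extend_basis[OF fd, of "C \<union> D"] car by blast
  show ?thesis
  proof (rule that[OF B(2,3)])
    show "span (B \<inter> N) = N" by (rule span_Int_eqI[OF N _ C(2,5)]) (use B(1) in blast)
    show "span (B \<inter> L) = L" by (rule span_Int_eqI[OF L _ D(2,5)]) (use B(1) in blast)
    show "span (B \<inter> (N \<inter> L)) = N \<inter> L"
      by (rule span_Int_eqI[OF NL _ B0(1,4)]) (use B(1) C(1) in blast)
  qed
qed

lemma automorphism_mem_iff:
  assumes Q: "Q \<in> lin_autos K V" and U: "subspace K U V" "subspace K U' V"
    and S: "S \<subseteq> U" "span S = U" "Q ` S \<subseteq> U'" "span (Q ` S) = U'" and x: "x \<in> carrier V"
  shows "Q x \<in> U' \<longleftrightarrow> x \<in> U"
proof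
  note Qh = lin_autosD(1)[OF Q]
  have "span S \<subseteq> {v \<in> carrier V. Q v \<in> U'}"
    by (rule span_subset_subspace[OF vimage_subspace[OF vectorspace_axioms Qh U(2)]])
      (use S subspaceD(1)[OF U(1)] in auto)
  then show "x \<in> U \<Longrightarrow> Q x \<in> U'" using S(2) by auto
  have "span (Q ` S) \<subseteq> Q ` U"
    by (rule span_subset_subspace[OF image_subspace[OF vectorspace_axioms Qh U(1)]])
      (use S in auto)
  then show "x \<in> U" if "Q x \<in> U'"
    using that S(4) inj_on_image_mem_iff[OF lin_autosD(2)[OF Q] x subspaceD(1)[OF U(1)]] by blast
qed

text \<open>An adapted basis falls into four classes, by membership in either subspace. The given
  dimensions fix the sizes of these classes, so two adapted bases can be matched class by
  class.\<close>

lemma automorphism_of_subspace_pairs: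
  assumes fd: fin_dim and sub: "subspace K N V" "subspace K L V" "subspace K N' V" "subspace K L' V"
    and dim: "vectorspace.dim K (vs N) = vectorspace.dim K (vs N')"
      "vectorspace.dim K (vs L) = vectorspace.dim K (vs L')"
      "vectorspace.dim K (vs (N \<inter> L)) = vectorspace.dim K (vs (N' \<inter> L'))"
  obtains Q where "Q \<in> lin_autos K V" "\<And>x. x \<in> carrier V \<Longrightarrow> Q x \<in> N' \<longleftrightarrow> x \<in> N"
    "\<And>x. x \<in> carrier V \<Longrightarrow> Q x \<in> L' \<longleftrightarrow> x \<in> L"
proof -
  obtain B where B: "finite B" "basis B" "span (B \<inter> N) = N" "span (B \<inter> L) = L"
    "span (B \<inter> (N \<inter> L)) = N \<inter> L"
    using adapted_basis[OF fd sub(1,2)] by blast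
  obtain C where C: "finite C" "basis C" "span (C \<inter> N') = N'" "span (C \<inter> L') = L'"
    "span (C \<inter> (N' \<inter> L')) = N' \<inter> L'"
    using adapted_basis[OF fd sub(3,4)] by blast
  have d: "vectorspace.dim K (vs U) = card (S \<inter> U)"
    if "subspace K U V" "finite S" "basis S" "span (S \<inter> U) = U" for U S
    by (rule dim_subspace_card[OF that(1)])
      (use that subset_li_is_li[of S "S \<inter> U"] in \<open>auto simp: basis_def\<close>)
  have cN: "card (B \<inter> N) = card (C \<inter> N')"
    using d[OF sub(1) B(1,2,3)] d[OF sub(3) C(1,2,3)] dim(1) by simp
  have cL: "card (B \<inter> L) = card (C \<inter> L')"
    using d[OF sub(2) B(1,2,4)] d[OF sub(4) C(1,2,4)] dim(2) by simp
  have cNL: "card (B \<inter> (N \<inter> L)) = card (C \<inter> (N' \<inter> L'))"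
    using d[OF subspace_Int[OF sub(1,2)] B(1,2,5)] d[OF subspace_Int[OF sub(3,4)] C(1,2,5)] dim(3)
    by simp
  have cB: "card B = card C" using dim_basis B(1,2) C(1,2) by metis
  \<comment> \<open>The size of each class is expressed through \<open>S\<close>, its parts in
    \<open>U\<close> and in \<open>W\<close>, and its part in both. The class outside both subspaces
    comes from inclusion-exclusion.\<close>
  have fib: "card {x \<in> S. (x \<in> U, x \<in> W) = (i, j)} =
      (if i then if j then card (S \<inter> (U \<inter> W)) else card (S \<inter> U) - card (S \<inter> (U \<inter> W))
       else if j then card (S \<inter> W) - card (S \<inter> (U \<inter> W))
       else card S + card (S \<inter> (U \<inter> W)) - (card (S \<inter> U) + card (S \<inter> W)))"
    if "finite S" for S U W :: "'c set" and i j
  proof -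
    have "{x \<in> S. x \<in> U \<and> x \<in> W} = S \<inter> (U \<inter> W)" by blast
    moreover have "{x \<in> S. x \<in> U \<and> x \<notin> W} = S \<inter> U - S \<inter> (U \<inter> W)"
      "{x \<in> S. x \<notin> U \<and> x \<in> W} = S \<inter> W - S \<inter> (U \<inter> W)"
      "{x \<in> S. x \<notin> U \<and> x \<notin> W} = S - (S \<inter> U \<union> S \<inter> W)" by blast+
    moreover have "card (S \<inter> U - S \<inter> (U \<inter> W)) = card (S \<inter> U) - card (S \<inter> (U \<inter> W))"
      "card (S \<inter> W - S \<inter> (U \<inter> W)) = card (S \<inter> W) - card (S \<inter> (U \<inter> W))"
      "card (S - (S \<inter> U \<union> S \<inter> W)) = card S - card (S \<inter> U \<union> S \<inter> W)"
      using that by (intro card_Diff_subset; blast)+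
    moreover have "card (S \<inter> U) + card (S \<inter> W) = card (S \<inter> U \<union> S \<inter> W) + card (S \<inter> (U \<inter> W))"
      using card_Un_Int[of "S \<inter> U" "S \<inter> W"] that by (simp add: Int_assoc Int_left_commute)
    ultimately show ?thesis by (cases i; cases j) auto
  qed
  have cards: "card {x \<in> B. (x \<in> N, x \<in> L) = c} = card {y \<in> C. (y \<in> N', y \<in> L') = c}" for c
    by (cases c) (simp only: fib[OF B(1)] fib[OF C(1)] cN cL cNL cB)
  obtain f where f: "bij_betw f B C" "\<And>x. x \<in> B \<Longrightarrow> (f x \<in> N', f x \<in> L') = (x \<in> N, x \<in> L)"
    using bij_betw_of_card_fibres[OF B(1) C(1) cards] by metis
  obtain Q where Q: "Q \<in> lin_autos K V" "\<And>b. b \<in> B \<Longrightarrow> Q b = f b"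
    using automorphism_of_bases[OF B(1,2) C(1,2) f(1)] by metis
  have "Q ` B = C" using Q(2) f(1) by (simp add: bij_betw_def)
  then have im: "Q ` (B \<inter> N) = C \<inter> N'" "Q ` (B \<inter> L) = C \<inter> L'"
    using f(2) Q(2) by auto
  show ?thesis
  proof (rule that[OF Q(1)])
    fix x assume x: "x \<in> carrier V"
    show "Q x \<in> N' \<longleftrightarrow> x \<in> N"
      by (rule automorphism_mem_iff[OF Q(1) sub(1,3) _ B(3) _ _ x]) (simp_all only: im C Int_lower2)
    show "Q x \<in> L' \<longleftrightarrow> x \<in> L"
      by (rule automorphism_mem_iff[OF Q(1) sub(2,4) _ B(4) _ _ x]) (simp_all only: im C Int_lower2)
  qed
qed

text \<open>A basis of \<open>U\<close> and its image under \<open>p\<close> have the same size.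
  When both are extended to bases of the whole space, equally many vectors are added, and these can
  be matched arbitrarily.\<close>

lemma automorphism_extension:
  assumes fd: fin_dim and U: "subspace K U V" and p: "p \<in> module_hom K (vs U) V"
    and inj: "inj_on p U"
  obtains P where "P \<in> lin_autos K V" "\<And>u. u \<in> U \<Longrightarrow> P u = p u"
proof -
  interpret U: vectorspace K "vs U" using subspace_is_vs[OF U] .
  have UV: "U \<subseteq> carrier V" using subspaceD(1)[OF U] .
  have sU: "submodule K U V" using U by simp
  let ?W = "p ` U"
  have W: "subspace K ?W V"
    using U.image_subspace[OF vectorspace_axioms p U.subspace_carrier] by simp
  interpret W: vectorspace K "vs ?W" using subspace_is_vs[OF W] .
  have pW: "p \<in> module_hom K (vs U) (vs ?W)"
    using p unfolding module_hom_def by auto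
  interpret p: linear_map K "vs U" "vs ?W" p
    using linear_mapI U.vectorspace_axioms W.vectorspace_axioms pW by blast
  obtain B where B: "B \<subseteq> U" "finite B" "lin_indpt B" "span B = U"
    using subspace_basis[OF fd U] by blast
  have bB: "U.basis B"
    unfolding U.basis_def using span_li_not_depend[OF B(1) sU] B by simp
  \<comment> \<open>Injectivity of \<open>p\<close> is used here: it makes the image of a basis of
    \<open>U\<close> a basis of the image of \<open>U\<close>.\<close>
  have "W.basis (p ` B)"
    using p.linear_inj_image_is_basis[OF _ _ bB fin_dim_subspace[OF fd U]] inj by simp
  then have liW: "lin_indpt (p ` B)"
    using span_li_not_depend(2)[of "p ` B" ?W] W B(1) unfolding W.basis_def by auto
  have pB: "p ` B \<subseteq> carrier V" using subspaceD(1)[OF W] B(1) by blast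
  obtain C where C: "B \<subseteq> C" "finite C" "basis C"
    using extend_basis[OF fd _ B(3)] B(1) UV by blast
  obtain D where D: "p ` B \<subseteq> D" "finite D" "basis D"
    using extend_basis[OF fd pB liW] by blast
  have injB: "inj_on p B" using inj_on_subset[OF inj B(1)] .
  have "card C = card D" using dim_basis C(2,3) D(2,3) by metis
  then have "card (C - B) = card (D - p ` B)"
    using card_Diff_subset[OF B(2) C(1)] card_Diff_subset[OF _ D(1)] card_image[OF injB] B(2) by simp
  then obtain h where h: "bij_betw h (C - B) (D - p ` B)"
    using finite_same_card_bij[of "C - B" "D - p ` B"] C(2) D(2) by auto
  \<comment> \<open>\<open>g\<close> follows \<open>p\<close> on the basis of \<open>U\<close> and
    the arbitrary matching \<open>h\<close> on the added vectors.\<close>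
  define g where "g x = (if x \<in> B then p x else h x)" for x
  have "bij_betw g B (p ` B)"
    using bij_betw_cong[of B g p] injB unfolding g_def bij_betw_def by auto
  moreover have "bij_betw g (C - B) (D - p ` B)"
    using bij_betw_cong[of "C - B" g h] h unfolding g_def by auto
  ultimately have "bij_betw g (B \<union> (C - B)) (p ` B \<union> (D - p ` B))"
    by (rule bij_betw_combine) blast
  then have "bij_betw g C D" using C(1) D(1) by (simp add: Un_absorb1)
  then obtain P where P: "P \<in> lin_autos K V" "\<And>b. b \<in> C \<Longrightarrow> P b = g b"
    using automorphism_of_bases[OF C(2,3) D(2,3)] by metis
  have PU: "P \<in> module_hom K (vs U) V"
    using module_hom_subspace[OF U lin_autosD(1)[OF P(1)]] .
  show ?thesis
  proof (rule that[OF P(1)])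
    fix u assume u: "u \<in> U"
    show "P u = p u"
    proof (rule U.hom_eq_on_span[OF vectorspace_axioms PU p])
      show "B \<subseteq> carrier (vs U)" using B(1) by simp
      show "P b = p b" if "b \<in> B" for b using P(2) that C(1) unfolding g_def by auto
      show "u \<in> U.span B" using span_li_not_depend(1)[OF B(1) sU] B(4) u by simp
    qed
  qed
qed

text \<open>Equal kernels make the assignment \<open>f w\<close> to \<open>g w\<close> both well
  defined and injective on the image of \<open>f\<close>. It then extends to an
  automorphism.\<close>

lemma automorphism_of_equal_kernels:
  assumes fd: fin_dim and W: "vectorspace K W"
    and fg: "f \<in> module_hom K W V" "g \<in> module_hom K W V"
    and ker: "\<And>w. w \<in> carrier W \<Longrightarrow> f w = \<zero>\<^bsub>V\<^esub> \<longleftrightarrow> g w = \<zero>\<^bsub>V\<^esub>"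
  obtains P where "P \<in> lin_autos K V" "\<And>w. w \<in> carrier W \<Longrightarrow> P (f w) = g w"
proof -
  interpret W: vectorspace K W by fact
  interpret f: linear_map K W V f using linear_mapI W vectorspace_axioms fg(1) by blast
  interpret g: linear_map K W V g using linear_mapI W vectorspace_axioms fg(2) by blast
  \<comment> \<open>The kernel condition is applied to the difference of \<open>w\<close> and
    \<open>w'\<close>.\<close>
  have eq_iff: "f w = f w' \<longleftrightarrow> g w = g w'" if "w \<in> carrier W" "w' \<in> carrier W" for w w'
    using ker[of "w \<ominus>\<^bsub>W\<^esub> w'"] that by simp
  let ?U = "f ` carrier W"
  have U: "subspace K ?U V"
    using W.image_subspace[OF vectorspace_axioms fg(1) W.subspace_carrier] .
  \<comment> \<open>A preimage under \<open>f\<close> is chosen; by \<open>eq_iff\<close> the value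
    does not depend on the choice.\<close>
  define p where "p u = g (inv_into (carrier W) f u)" for u
  have p: "p (f w) = g w" if w: "w \<in> carrier W" for w
    unfolding p_def using eq_iff[of "inv_into (carrier W) f (f w)" w] w
    by (simp add: f_inv_into_f inv_into_into)
  have "p \<in> module_hom K (vs ?U) V"
  proof (rule module_homI)
    fix x y assume "x \<in> carrier (vs ?U)" "y \<in> carrier (vs ?U)"
    then obtain v w where "v \<in> carrier W" "w \<in> carrier W" "x = f v" "y = f w" by auto
    then show "p (x \<oplus>\<^bsub>vs ?U\<^esub> y) = p x \<oplus>\<^bsub>V\<^esub> p y"
      using p[of "v \<oplus>\<^bsub>W\<^esub> w"] p[of v] p[of w] by simp
  next
    fix r x assume r: "r \<in> carrier K" and "x \<in> carrier (vs ?U)"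
    then obtain v where "v \<in> carrier W" "x = f v" by auto
    then show "p (r \<odot>\<^bsub>vs ?U\<^esub> x) = r \<odot>\<^bsub>V\<^esub> p x"
      using p[of "r \<odot>\<^bsub>W\<^esub> v"] p[of v] r by simp
  qed (auto simp: p)
  moreover have "inj_on p ?U" by (rule inj_onI) (auto simp: p eq_iff)
  ultimately obtain P where "P \<in> lin_autos K V" "\<And>u. u \<in> ?U \<Longrightarrow> P u = p u"
    using automorphism_extension[OF fd U] by metis
  then show ?thesis using that p by (metis imageI)
qed

end

section \<open>Dimensions and quotient spaces\<close>

text \<open>Every axiom is transported along \<open>p\<close>, because each element of
  \<open>W\<close> is some \<open>p u\<close>. This is how the quotient record is recognised as a
  vector space.\<close>

lemma vectorspace_surj_image:
  assumes V: "vectorspace K V" and p: "p \<in> module_hom K V W" "p ` carrier V = carrier W"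
    "p \<zero>\<^bsub>V\<^esub> = \<zero>\<^bsub>W\<^esub>"
  shows "vectorspace K W"
proof -
  interpret V: vectorspace K V by fact
  have add: "p u \<oplus>\<^bsub>W\<^esub> p v = p (u \<oplus>\<^bsub>V\<^esub> v)" if "u \<in> carrier V" "v \<in> carrier V" for u v
    using module_hom_add[OF p(1) that] by simp
  have smult: "c \<odot>\<^bsub>W\<^esub> p v = p (c \<odot>\<^bsub>V\<^esub> v)" if "c \<in> carrier K" "v \<in> carrier V" for c v
    using module_hom_smult[OF p(1) that] by simp
  note eqs = p(2)[symmetric] p(3)[symmetric] add smult
  show ?thesis
  proof (rule vs_criteria)
    show "field K" by (rule V.field_axioms)
    show "\<forall>v\<in>carrier W. \<exists>w\<in>carrier W. v \<oplus>\<^bsub>W\<^esub> w = \<zero>\<^bsub>W\<^esub>"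
    proof
      fix v assume "v \<in> carrier W"
      then obtain u where u: "u \<in> carrier V" "v = p u" using p(2) by blast
      then have "v \<oplus>\<^bsub>W\<^esub> p (\<ominus>\<^bsub>V\<^esub> u) = \<zero>\<^bsub>W\<^esub>" by (simp add: add p(3) V.r_neg)
      then show "\<exists>w\<in>carrier W. v \<oplus>\<^bsub>W\<^esub> w = \<zero>\<^bsub>W\<^esub>" using u(1) p(2) V.a_inv_closed by blast
    qed
  qed (auto simp: eqs V.a_ac V.smult_assoc1 V.smult_l_distr V.smult_r_distr)
qed

lemma direct_sum_hom:
  assumes "vectorspace K V" "f \<in> module_hom K M V" "g \<in> module_hom K N V"
  shows "(\<lambda>p. f (fst p) \<oplus>\<^bsub>V\<^esub> g (snd p)) \<in> module_hom K (direct_sum M N) V"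
proof -
  interpret V: vectorspace K V by fact
  show ?thesis
    using assms(2,3) unfolding module_hom_def direct_sum_def Pi_def
    by (auto simp: V.a_ac V.smult_r_distr)
qed

context vectorspace
begin

text \<open>All three dimension formulas for a system come from this form, applied to
  \<open>E\<close> and to coset maps.\<close>

lemma rank_nullity_subspace:
  assumes fd: fin_dim and W: "vectorspace K W" and T: "T \<in> module_hom K V W" and U: "subspace K U V"
  shows "vectorspace.dim K (W\<lparr>carrier := T ` U\<rparr>) + vectorspace.dim K (vs {u \<in> U. T u = \<zero>\<^bsub>W\<^esub>})
    = vectorspace.dim K (vs U)"
proof -
  interpret T: linear_map K "vs U" W T
    using linear_mapI[OF subspace_is_vs[OF U] W module_hom_subspace[OF U T]] .
  show ?thesis
    using T.rank_nullity[OF fin_dim_subspace[OF fd U]] unfolding T.im_def T.ker_def by simp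
qed

lemma dim_zero_subspace: "vectorspace.dim K (vs {\<zero>\<^bsub>V\<^esub>}) = 0"
proof -
  have "subspace K {\<zero>\<^bsub>V\<^esub>} V" by (rule subspaceI) auto
  then show ?thesis using dim_subspace_card[of _ "{}"] lin_indpt_empty span_empty by simp
qed

text \<open>\<open>Q\<close> maps \<open>U'\<close> onto \<open>U\<close>, and its kernel on
  \<open>U'\<close> is zero.\<close>

lemma dim_automorphism_vimage:
  assumes fd: fin_dim and Q: "Q \<in> lin_autos K V" and U: "subspace K U V" "subspace K U' V"
    and iff: "\<And>x. x \<in> carrier V \<Longrightarrow> x \<in> U' \<longleftrightarrow> Q x \<in> U"
  shows "vectorspace.dim K (vs U') = vectorspace.dim K (vs U)"
proof -
  note D = lin_autosD[OF Q]
  interpret Q: linear_map K V V Q using linear_mapI vectorspace_axioms D(1) by blast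
  have "Q ` U' = U"
  proof (intro equalityI subsetI)
    fix y assume y: "y \<in> U"
    then obtain x where "x \<in> carrier V" "y = Q x" using D(3) subspaceD(1)[OF U(1)] by blast
    then show "y \<in> Q ` U'" using iff y by blast
  qed (use iff subspaceD(1)[OF U(2)] in auto)
  moreover have "{u \<in> U'. Q u = \<zero>\<^bsub>V\<^esub>} = {\<zero>\<^bsub>V\<^esub>}"
    using inj_onD[OF D(2), of _ "\<zero>\<^bsub>V\<^esub>"] subspaceD(1,2)[OF U(2)] by auto
  ultimately show ?thesis
    using rank_nullity_subspace[OF fd vectorspace_axioms D(1) U(2)] dim_zero_subspace by simp
qed

section \<open>Cosets, quotient spaces and induced maps\<close>

lemma subspace_abelian_subgroup:
  assumes "subspace K U V"
  shows "abelian_subgroup U V"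
proof (rule abelian_subgroupI3)
  note D = subspaceD[OF assms]
  have "subgroup U (add_monoid V)"
    by (rule add.subgroupI) (use D in \<open>auto simp: a_inv_def[symmetric]\<close>)
  then show "additive_subgroup U V" by (rule additive_subgroupI)
  show "abelian_group V" by (rule abelian_group_axioms)
qed

lemma coset_zero_iff:
  assumes U: "subspace K U V" and x: "x \<in> carrier V"
  shows "U +>\<^bsub>V\<^esub> x = U \<longleftrightarrow> x \<in> U"
proof -
  interpret abelian_subgroup U V by (rule subspace_abelian_subgroup[OF U])
  show ?thesis using a_rcos_self[OF x] a_coset_join2[OF x a_subgroup] by blast
qed

lemma coset_eq_iff:
  assumes U: "subspace K U V" and x: "x \<in> carrier V" "y \<in> carrier V"
  shows "U +>\<^bsub>V\<^esub> x = U +>\<^bsub>V\<^esub> y \<longleftrightarrow> x \<ominus>\<^bsub>V\<^esub> y \<in> U"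
proof -
  interpret abelian_subgroup U V by (rule subspace_abelian_subgroup[OF U])
  have xy: "(x \<ominus>\<^bsub>V\<^esub> y) \<oplus>\<^bsub>V\<^esub> y = x" using x by (simp add: a_minus_def a_assoc l_neg)
  show ?thesis
  proof
    assume "U +>\<^bsub>V\<^esub> x = U +>\<^bsub>V\<^esub> y"
    then obtain u where u: "u \<in> U" "x = u \<oplus>\<^bsub>V\<^esub> y"
      using a_rcos_self[OF x(1)] unfolding a_r_coset_def' by auto
    then have "x \<ominus>\<^bsub>V\<^esub> y = u"
      using x subspaceD(1)[OF U] by (auto simp: a_minus_def a_assoc r_neg)
    then show "x \<ominus>\<^bsub>V\<^esub> y \<in> U" using u by simp
  next
    assume "x \<ominus>\<^bsub>V\<^esub> y \<in> U"
    then have "x \<in> U +>\<^bsub>V\<^esub> y" using xy unfolding a_r_coset_def' by force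
    then show "U +>\<^bsub>V\<^esub> x = U +>\<^bsub>V\<^esub> y" using a_repr_independence[OF _ x(2) a_subgroup] by simp
  qed
qed

text \<open>Scalar multiplication on the quotient and induced maps are unions over all
  representatives of a coset. Such a union collapses once its terms agree, because a coset is
  nonempty.\<close>

lemma Union_coset_const:
  assumes U: "subspace K U V" and x: "x \<in> carrier V"
    and f: "\<And>y. y \<in> U +>\<^bsub>V\<^esub> x \<Longrightarrow> f y = X"
  shows "(\<Union>y\<in>U +>\<^bsub>V\<^esub> x. f y) = X"
proof -
  interpret abelian_subgroup U V by (rule subspace_abelian_subgroup[OF U])
  show ?thesis using a_rcos_self[OF x] f by auto
qed

lemma coset_memD:
  assumes U: "subspace K U V" and x: "x \<in> carrier V" and y: "y \<in> U +>\<^bsub>V\<^esub> x"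
  shows "y \<in> carrier V" "y \<ominus>\<^bsub>V\<^esub> x \<in> U"
proof -
  interpret abelian_subgroup U V by (rule subspace_abelian_subgroup[OF U])
  show yV: "y \<in> carrier V" using a_r_coset_subset_G[OF subspaceD(1)[OF U] x] y by blast
  show "y \<ominus>\<^bsub>V\<^esub> x \<in> U"
    using coset_eq_iff[OF U yV x] a_repr_independence[OF y x a_subgroup] by simp
qed

lemma carrier_quotient_space: "carrier (quotient_space V U) = (\<lambda>x. U +>\<^bsub>V\<^esub> x) ` carrier V"
  unfolding quotient_space_def A_RCOSETS_def' by auto

lemma zero_quotient_space: "\<zero>\<^bsub>quotient_space V U\<^esub> = U"
  unfolding quotient_space_def by simp

lemma coset_hom:
  assumes U: "subspace K U V"
  shows "(\<lambda>x. U +>\<^bsub>V\<^esub> x) \<in> module_hom K V (quotient_space V U)"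
proof -
  interpret abelian_subgroup U V by (rule subspace_abelian_subgroup[OF U])
  show ?thesis
  proof (rule module_homI)
    fix x y assume "x \<in> carrier V" "y \<in> carrier V"
    then show "U +>\<^bsub>V\<^esub> (x \<oplus>\<^bsub>V\<^esub> y) = (U +>\<^bsub>V\<^esub> x) \<oplus>\<^bsub>quotient_space V U\<^esub> (U +>\<^bsub>V\<^esub> y)"
      unfolding quotient_space_def by (simp add: a_rcos_sum)
  next
    fix r x assume r: "r \<in> carrier K" and x: "x \<in> carrier V"
    \<comment> \<open>Scalar multiplication is well defined: representatives differ by an element of
      \<open>U\<close>, and so do their multiples.\<close>
    have "(\<Union>y\<in>U +>\<^bsub>V\<^esub> x. U +>\<^bsub>V\<^esub> (r \<odot>\<^bsub>V\<^esub> y)) = U +>\<^bsub>V\<^esub> (r \<odot>\<^bsub>V\<^esub> x)"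
    proof (rule Union_coset_const[OF U x])
      fix y assume y: "y \<in> U +>\<^bsub>V\<^esub> x"
      have yV: "y \<in> carrier V" using coset_memD(1)[OF U x y] .
      have "r \<odot>\<^bsub>V\<^esub> y \<ominus>\<^bsub>V\<^esub> r \<odot>\<^bsub>V\<^esub> x = r \<odot>\<^bsub>V\<^esub> (y \<ominus>\<^bsub>V\<^esub> x)"
        using r x yV by (simp add: a_minus_def smult_r_distr smult_r_minus)
      then show "U +>\<^bsub>V\<^esub> (r \<odot>\<^bsub>V\<^esub> y) = U +>\<^bsub>V\<^esub> (r \<odot>\<^bsub>V\<^esub> x)"
        using coset_eq_iff[OF U] subspaceD(4)[OF U r coset_memD(2)[OF U x y]] r x yV by simp
    qed
    then show "U +>\<^bsub>V\<^esub> (r \<odot>\<^bsub>V\<^esub> x) = r \<odot>\<^bsub>quotient_space V U\<^esub> (U +>\<^bsub>V\<^esub> x)"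
      unfolding quotient_space_def by simp
  qed (simp add: carrier_quotient_space)
qed

lemma quotient_vectorspace:
  assumes U: "subspace K U V"
  shows "vectorspace K (quotient_space V U)"
proof (rule vectorspace_surj_image[OF vectorspace_axioms coset_hom[OF U]])
  show "U +>\<^bsub>V\<^esub> \<zero>\<^bsub>V\<^esub> = \<zero>\<^bsub>quotient_space V U\<^esub>"
    using coset_zero_iff[OF U] subspaceD(2)[OF U] by (simp add: zero_quotient_space)
qed (simp add: carrier_quotient_space)

text \<open>The coset map restricted to \<open>W\<close> has kernel
  \<open>W \<inter> U\<close>.\<close>

lemma dim_coset_image:
  assumes fd: fin_dim and U: "subspace K U V" and W: "subspace K W V"
  shows "vectorspace.dim K ((quotient_space V U)\<lparr>carrier := (\<lambda>x. U +>\<^bsub>V\<^esub> x) ` W\<rparr>)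
      + vectorspace.dim K (vs (W \<inter> U)) = vectorspace.dim K (vs W)"
proof -
  have "{w \<in> W. U +>\<^bsub>V\<^esub> w = \<zero>\<^bsub>quotient_space V U\<^esub>} = W \<inter> U"
    using coset_zero_iff[OF U] subspaceD(1)[OF W] by (auto simp: zero_quotient_space)
  then show ?thesis
    using rank_nullity_subspace[OF fd quotient_vectorspace[OF U] coset_hom[OF U] W] by simp
qed

lemma dim_quotient_space:
  assumes fd: fin_dim and U: "subspace K U V"
  shows "vectorspace.dim K (quotient_space V U) + vectorspace.dim K (vs U) = dim"
  using dim_coset_image[OF fd U subspace_carrier] subspaceD(1)[OF U]
  by (simp add: carrier_quotient_space[symmetric] Int_absorb1)

text \<open>Two representatives differ by an element of \<open>U\<close>, which \<open>f\<close>
  sends into \<open>U'\<close>.\<close>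

lemma induced_map_coset:
  assumes V: "vectorspace K W" and f: "f \<in> module_hom K V W"
    and U: "subspace K U V" "subspace K U' W" "f ` U \<subseteq> U'" and x: "x \<in> carrier V"
  shows "induced_map W U' f (U +>\<^bsub>V\<^esub> x) = U' +>\<^bsub>W\<^esub> f x"
  unfolding induced_map_def
proof (rule Union_coset_const[OF U(1) x])
  interpret W: vectorspace K W by fact
  interpret f: linear_map K V W f using linear_mapI vectorspace_axioms V f by blast
  fix y assume y: "y \<in> U +>\<^bsub>V\<^esub> x"
  note yD = coset_memD[OF U(1) x y]
  have "f y \<ominus>\<^bsub>W\<^esub> f x \<in> U'" using f.f_minus[OF yD(1) x] yD(2) U(3) by force
  then show "U' +>\<^bsub>W\<^esub> f y = U' +>\<^bsub>W\<^esub> f x" using W.coset_eq_iff[OF U(2)] yD(1) x by simp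
qed

lemma induced_map_hom:
  assumes W: "vectorspace K W" and f: "f \<in> module_hom K V W"
    and U: "subspace K U V" "subspace K U' W" "f ` U \<subseteq> U'"
  shows "induced_map W U' f \<in> module_hom K (quotient_space V U) (quotient_space W U')"
proof -
  interpret W: vectorspace K W by fact
  interpret f: linear_map K V W f using linear_mapI vectorspace_axioms W f by blast
  note ind = induced_map_coset[OF W f U]
  note p = coset_hom[OF U(1)] and q = W.coset_hom[OF U(2)]
  show ?thesis
  proof (rule module_homI)
    fix X assume "X \<in> carrier (quotient_space V U)"
    then show "induced_map W U' f X \<in> carrier (quotient_space W U')"
      by (auto simp: carrier_quotient_space W.carrier_quotient_space ind)
  next
    fix X Y assume "X \<in> carrier (quotient_space V U)" "Y \<in> carrier (quotient_space V U)"
    then obtain x y where xy: "x \<in> carrier V" "y \<in> carrier V"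
      and XY: "X = U +>\<^bsub>V\<^esub> x" "Y = U +>\<^bsub>V\<^esub> y"
      by (auto simp: carrier_quotient_space)
    have "X \<oplus>\<^bsub>quotient_space V U\<^esub> Y = U +>\<^bsub>V\<^esub> (x \<oplus>\<^bsub>V\<^esub> y)"
      using module_hom_add[OF p xy] XY by simp
    then show "induced_map W U' f (X \<oplus>\<^bsub>quotient_space V U\<^esub> Y)
        = induced_map W U' f X \<oplus>\<^bsub>quotient_space W U'\<^esub> induced_map W U' f Y"
      using module_hom_add[OF q, of "f x" "f y"] xy XY by (simp add: ind)
  next
    fix r X assume r: "r \<in> carrier K" and "X \<in> carrier (quotient_space V U)"
    then obtain x where x: "x \<in> carrier V" and X: "X = U +>\<^bsub>V\<^esub> x"
      by (auto simp: carrier_quotient_space)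
    have "r \<odot>\<^bsub>quotient_space V U\<^esub> X = U +>\<^bsub>V\<^esub> (r \<odot>\<^bsub>V\<^esub> x)"
      using module_hom_smult[OF p r x] X by simp
    then show "induced_map W U' f (r \<odot>\<^bsub>quotient_space V U\<^esub> X)
        = r \<odot>\<^bsub>quotient_space W U'\<^esub> induced_map W U' f X"
      using module_hom_smult[OF q r, of "f x"] r x X by (simp add: ind)
  qed
qed

end

section \<open>Systems under weak equivalence\<close>

locale linear_system =
  M: vectorspace K M + V: vectorspace K V
  for K :: "('k, 'c) ring_scheme" and M :: "('k, 'm, 'd) module_scheme"
    and V :: "('k, 'v, 'e) module_scheme" +
  fixes E A :: "'m \<Rightarrow> 'v"
  assumes M_fin_dim: "M.fin_dim" and V_fin_dim: "V.fin_dim"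
    and system: "(E, A) \<in> systems K M V"
begin

section \<open>The subspaces attached to a system\<close>

lemma E_hom: "E \<in> module_hom K M V" and A_hom: "A \<in> module_hom K M V"
  using system unfolding systems_def lin_maps_def by auto

sublocale E: linear_map K M V E
  by (rule linear_mapI[OF M.vectorspace_axioms V.vectorspace_axioms E_hom])

sublocale A: linear_map K M V A
  by (rule linear_mapI[OF M.vectorspace_axioms V.vectorspace_axioms A_hom])

definition kernel :: "'m set" where "kernel = {x \<in> carrier M. E x = \<zero>\<^bsub>V\<^esub>}"

lemma kernel_subspace: "subspace K kernel M"
  using E.kerT_is_subspace unfolding E.ker_def kernel_def .

lemma codom1_subspace: "subspace K (codom1 M E) V"
  unfolding codom1_def
  by (rule M.image_subspace[OF V.vectorspace_axioms E_hom M.subspace_carrier])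

lemma dom1_subspace: "subspace K (dom1 M E A) M"
  unfolding dom1_def by (rule M.vimage_subspace[OF V.vectorspace_axioms A_hom codom1_subspace])

lemma dom1_subset: "dom1 M E A \<subseteq> carrier M"
  using M.subspaceD(1)[OF dom1_subspace] .

lemma codom2_subspace: "subspace K (codom2 M E A) V"
  unfolding codom2_def by (rule M.image_subspace[OF V.vectorspace_axioms E_hom dom1_subspace])

lemma codom1_vectorspace: "vectorspace K (V\<lparr>carrier := codom1 M E\<rparr>)"
  using V.subspace_is_vs[OF codom1_subspace] .

lemma codom2_subset_codom1: "codom2 M E A \<subseteq> codom1 M E"
  unfolding codom2_def codom1_def using dom1_subset by blast

lemma codom2_subspace_codom1: "subspace K (codom2 M E A) (V\<lparr>carrier := codom1 M E\<rparr>)"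
proof -
  interpret W: vectorspace K "V\<lparr>carrier := codom1 M E\<rparr>" by (rule codom1_vectorspace)
  show ?thesis
    by (rule W.subspaceI) (use codom2_subset_codom1 V.subspaceD[OF codom2_subspace] in auto)
qed

lemma E_hom_codom1: "E \<in> module_hom K M (V\<lparr>carrier := codom1 M E\<rparr>)"
  by (rule module_homI) (auto simp: codom1_def)

section \<open>The three integers as dimensions of subspaces of the domain\<close>

lemma dim_d:
  "inv_d K M V E A + vectorspace.dim K (M\<lparr>carrier := kernel \<inter> dom1 M E A\<rparr>)
    = vectorspace.dim K (M\<lparr>carrier := dom1 M E A\<rparr>)"
proof -
  have "{u \<in> dom1 M E A. E u = \<zero>\<^bsub>V\<^esub>} = kernel \<inter> dom1 M E A"
    using dom1_subset unfolding kernel_def by blast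
  then show ?thesis
    using M.rank_nullity_subspace[OF M_fin_dim V.vectorspace_axioms E_hom dom1_subspace]
    unfolding inv_d_def codom2_def by simp
qed

text \<open>\<open>[E]\<close> kills the coset of \<open>x\<close> exactly when
  \<open>E x = E l\<close> for some \<open>l\<close> in \<open>M'\<close>. Then \<open>x - l\<close>
  is a representative of the same coset lying in the kernel of \<open>E\<close>.\<close>

lemma ker_induced_eq: "ker_induced M V E A = (\<lambda>x. dom1 M E A +>\<^bsub>M\<^esub> x) ` kernel"
proof -
  let ?L = "dom1 M E A" and ?W = "V\<lparr>carrier := codom1 M E\<rparr>" and ?U = "codom2 M E A"
  interpret W: vectorspace K ?W by (rule codom1_vectorspace)
  have im: "E ` ?L \<subseteq> ?U" unfolding codom2_def by simp
  \<comment> \<open>The codomain of \<open>[E]\<close> is a quotient of \<open>V'\<close>, while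
    \<open>induced_map\<close> is formed in \<open>V\<close>. Both ambient spaces have the same
    addition, so the cosets are the same sets.\<close>
  have coset_W: "?U +>\<^bsub>?W\<^esub> y = ?U +>\<^bsub>V\<^esub> y" for y
    unfolding a_r_coset_def' by simp
  have W_induced: "induced_map ?W ?U E = induced_map V ?U E"
    unfolding induced_map_def coset_W by (rule refl)
  have hom: "induced_map V ?U E \<in> module_hom K (dom_quotient M E A) (codom_quotient M V E A)"
    using M.induced_map_hom[OF W.vectorspace_axioms E_hom_codom1 dom1_subspace
        codom2_subspace_codom1 im]
    unfolding W_induced dom_quotient_def codom_quotient_def .
  interpret ind: linear_map K "dom_quotient M E A" "codom_quotient M V E A" "induced_map V ?U E"
    by (rule linear_mapI[OF _ _ hom])
      (simp_all add: dom_quotient_def codom_quotient_def M.quotient_vectorspace[OF dom1_subspace]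
        W.quotient_vectorspace[OF codom2_subspace_codom1])
  have coset: "induced_map V ?U E (?L +>\<^bsub>M\<^esub> x) = ?U \<longleftrightarrow> E x \<in> ?U" if "x \<in> carrier M" for x
    using M.induced_map_coset[OF V.vectorspace_axioms E_hom dom1_subspace codom2_subspace im that]
      V.coset_zero_iff[OF codom2_subspace] that by simp
  have "ker_induced M V E A = {X \<in> carrier (dom_quotient M E A). induced_map V ?U E X = ?U}"
    unfolding ker_induced_def ind.ker_def by (simp add: codom_quotient_def W.zero_quotient_space)
  also have "\<dots> = (\<lambda>x. ?L +>\<^bsub>M\<^esub> x) ` {x \<in> carrier M. E x \<in> ?U}"
    unfolding dom_quotient_def M.carrier_quotient_space using coset by auto
  also have "\<dots> = (\<lambda>x. ?L +>\<^bsub>M\<^esub> x) ` kernel"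
  proof (intro equalityI subsetI)
    fix X assume "X \<in> (\<lambda>x. ?L +>\<^bsub>M\<^esub> x) ` {x \<in> carrier M. E x \<in> ?U}"
    then obtain x where x: "x \<in> carrier M" "E x \<in> ?U" "X = ?L +>\<^bsub>M\<^esub> x" by blast
    then obtain l where l: "l \<in> ?L" "E x = E l" unfolding codom2_def by blast
    have lM: "l \<in> carrier M" using l dom1_subset by blast
    have "x \<ominus>\<^bsub>M\<^esub> l \<in> kernel" unfolding kernel_def using x(1) lM l(2) by simp
    moreover have "?L +>\<^bsub>M\<^esub> (x \<ominus>\<^bsub>M\<^esub> l) = X"
    proof -
      have "x \<ominus>\<^bsub>M\<^esub> (x \<ominus>\<^bsub>M\<^esub> l) = l"
        using x(1) lM by (simp add: a_minus_def M.minus_add M.a_assoc[symmetric] M.r_neg)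
      then show ?thesis
        using M.coset_eq_iff[OF dom1_subspace x(1), of "x \<ominus>\<^bsub>M\<^esub> l"] x lM l(1) by simp
    qed
    ultimately show "X \<in> (\<lambda>x. ?L +>\<^bsub>M\<^esub> x) ` kernel" by blast
  next
    fix X assume "X \<in> (\<lambda>x. ?L +>\<^bsub>M\<^esub> x) ` kernel"
    then show "X \<in> (\<lambda>x. ?L +>\<^bsub>M\<^esub> x) ` {x \<in> carrier M. E x \<in> ?U}"
      using V.subspaceD(2)[OF codom2_subspace] unfolding kernel_def by auto
  qed
  finally show ?thesis .
qed

lemma dim_a:
  "inv_a K M V E A + vectorspace.dim K (M\<lparr>carrier := kernel \<inter> dom1 M E A\<rparr>)
    = vectorspace.dim K (M\<lparr>carrier := kernel\<rparr>)"
  using M.dim_coset_image[OF M_fin_dim dom1_subspace kernel_subspace]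
  unfolding inv_a_def ker_induced_eq dom_quotient_def .

text \<open>The dimension of the quotient \<open>V'/V''\<close> adds up with \<open>d\<close> to
  \<open>dim V'\<close>, and rank-nullity for \<open>E\<close> on all of \<open>M\<close> does the
  rest.\<close>

lemma dim_s: "inv_s K M V E A + inv_d K M V E A + vectorspace.dim K (M\<lparr>carrier := kernel\<rparr>) = M.dim"
proof -
  interpret W: vectorspace K "V\<lparr>carrier := codom1 M E\<rparr>" by (rule codom1_vectorspace)
  have "inv_s K M V E A + inv_d K M V E A = W.dim"
    using W.dim_quotient_space[OF V.fin_dim_subspace[OF V_fin_dim codom1_subspace]
        codom2_subspace_codom1]
    unfolding inv_s_def inv_d_def codom_quotient_def by simp
  moreover have "W.dim + vectorspace.dim K (M\<lparr>carrier := kernel\<rparr>) = M.dim"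
    using M.rank_nullity_subspace[OF M_fin_dim V.vectorspace_axioms E_hom M.subspace_carrier]
    unfolding codom1_def kernel_def by simp
  ultimately show ?thesis by simp
qed

text \<open>On \<open>M'\<close> the values of \<open>A\<close> lie in the image of
  \<open>E\<close>, so they lift through \<open>E\<close> to a linear map \<open>R\<close>.
  Subtracting \<open>ER\<close> kills \<open>A\<close> on \<open>M'\<close> and leaves the preimage
  of \<open>V'\<close> unchanged.\<close>

lemma split_off_image:
  obtains R B where "R \<in> lin_maps K M M" "(E, B) \<in> systems K M V"
    "\<forall>x\<in>carrier M. A x = E (R x) \<oplus>\<^bsub>V\<^esub> B x"
    "\<forall>x\<in>carrier M. B x \<in> codom1 M E \<longleftrightarrow> B x = \<zero>\<^bsub>V\<^esub>"
    "\<forall>x\<in>carrier M. B x = \<zero>\<^bsub>V\<^esub> \<longleftrightarrow> x \<in> dom1 M E A"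
proof -
  let ?L = "dom1 M E A"
  obtain S where S: "S \<subseteq> ?L" "finite S" "M.lin_indpt S" "M.span S = ?L"
    using M.subspace_basis[OF M_fin_dim dom1_subspace] by blast
  have SM: "S \<subseteq> carrier M" using S(1) dom1_subset by blast
  obtain T where T: "S \<subseteq> T" "finite T" "M.basis T"
    using M.extend_basis[OF M_fin_dim SM S(3)] by blast
  \<comment> \<open>The lift matters only on the basis \<open>S\<close> of \<open>M'\<close>.
    Elsewhere any vector of \<open>M\<close> is allowed, so that \<open>r\<close> can be chosen on
    all of \<open>T\<close>.\<close>
  have "\<exists>y\<in>carrier M. b \<in> S \<longrightarrow> E y = A b" for b
  proof (cases "b \<in> S")
    case True
    then have "A b \<in> E ` carrier M" using S(1) unfolding dom1_def codom1_def by blast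
    then show ?thesis by (metis imageE)
  qed (use M.zero_closed in blast)
  then obtain r where r: "\<And>b. r b \<in> carrier M" "\<And>b. b \<in> S \<Longrightarrow> E (r b) = A b" by metis
  then obtain R0 where R0: "R0 \<in> module_hom K M M" "\<And>b. b \<in> T \<Longrightarrow> R0 b = r b"
    using M.linear_extension[OF T(2,3) M.vectorspace_axioms, of r] by (metis Pi_I)
  define R where "R = restrict R0 (carrier M)"
  define B where "B = (\<lambda>x\<in>carrier M. (\<ominus>\<^bsub>V\<^esub> E (R x)) \<oplus>\<^bsub>V\<^esub> A x)"
  have R: "R \<in> module_hom K M M"
    unfolding R_def by (rule module_hom_cong[OF M.module_axioms R0(1)]) simp
  have RM: "R x \<in> carrier M" if "x \<in> carrier M" for x
    using module_hom_closed[OF R] that by auto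
  have ER: "(\<lambda>x. E (R x)) \<in> module_hom K M V" by (rule module_hom_comp[OF R E_hom])
  have B: "B \<in> module_hom K M V"
    unfolding B_def
    by (rule module_hom_cong[OF M.module_axioms
          module_hom_add_maps[OF M.module_axioms V.module_axioms
            module_hom_neg[OF M.module_axioms V.module_axioms ER] A_hom]]) simp
  interpret B: linear_map K M V B
    by (rule linear_mapI[OF M.vectorspace_axioms V.vectorspace_axioms B])
  have AB: "A x = E (R x) \<oplus>\<^bsub>V\<^esub> B x" if "x \<in> carrier M" for x
    using that RM[OF that] unfolding B_def by (simp add: V.r_neg V.a_assoc[symmetric])
  have "B b = \<zero>\<^bsub>V\<^esub>" if b: "b \<in> S" for b
  proof -
    have "E (R b) = A b" using b T(1) SM R0(2) r(2) unfolding R_def by auto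
    then show ?thesis using b SM unfolding B_def by (auto simp: V.l_neg)
  qed
  then have "S \<subseteq> {x \<in> carrier M. B x = \<zero>\<^bsub>V\<^esub>}" using SM by auto
  then have L0: "B x = \<zero>\<^bsub>V\<^esub>" if "x \<in> ?L" for x
    using M.span_subset_subspace[OF B.kerT_is_subspace, of S] that S(4) unfolding B.ker_def by auto
  \<comment> \<open>\<open>A x\<close> and \<open>B x\<close> differ by \<open>E (R x)\<close>, an
    element of \<open>V'\<close>, so if one is in \<open>V'\<close> the other is too.\<close>
  have L: "x \<in> ?L" if x: "x \<in> carrier M" "B x \<in> codom1 M E" for x
  proof -
    have "E (R x) \<in> codom1 M E" unfolding codom1_def using RM x(1) by blast
    then show ?thesis
      unfolding dom1_def using AB[OF x(1)] V.subspaceD(3)[OF codom1_subspace] x by auto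
  qed
  have 0: "\<zero>\<^bsub>V\<^esub> \<in> codom1 M E" using V.subspaceD(2)[OF codom1_subspace] .
  show ?thesis
  proof (rule that)
    show "\<forall>x\<in>carrier M. A x = E (R x) \<oplus>\<^bsub>V\<^esub> B x" using AB by blast
    show "R \<in> lin_maps K M M" using R unfolding lin_maps_def R_def by simp
    show "(E, B) \<in> systems K M V"
      using B system unfolding systems_def lin_maps_def B_def by simp
  qed (use L L0 0 in metis)+
qed

end

section \<open>Invariance under the action\<close>

lemma weak_action_apply:
  assumes "(E, A) \<in> systems K M V" "weak_action K M V (P, Q, R) (E, A) = (E', A')" "x \<in> carrier M"
  shows "E' x = P (E (Q x))" "A' x = P (E (R x) \<oplus>\<^bsub>V\<^esub> A (Q x))"
  using assms unfolding weak_action_def by auto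

lemma weak_action_eqI:
  assumes S: "(E, A) \<in> systems K M V" "(E', A') \<in> systems K M V"
    and "\<And>x. x \<in> carrier M \<Longrightarrow> E' x = P (E (Q x))"
    and "\<And>x. x \<in> carrier M \<Longrightarrow> A' x = P (E (R x) \<oplus>\<^bsub>V\<^esub> A (Q x))"
  shows "weak_action K M V (P, Q, R) (E, A) = (E', A')"
proof -
  have "E' \<in> extensional (carrier M)" "A' \<in> extensional (carrier M)"
    using S(2) unfolding systems_def lin_maps_def by auto
  then show ?thesis
    unfolding weak_action_def using assms by (auto simp: fun_eq_iff extensional_def)
qed

text \<open>\<open>P\<close> is injective and the term \<open>ER\<close> moves values only within
  \<open>V'\<close>. Hence membership in the kernel of \<open>E'\<close> and in the new
  \<open>M'\<close> is decided by \<open>Q x\<close> alone.\<close>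

lemma invariants_weak_action:
  assumes S: "linear_system K M V E A" "linear_system K M V E' A'"
    and g: "g \<in> carrier (weak_group K M V)" "weak_action K M V g (E, A) = (E', A')"
  shows "inv_d K M V E A = inv_d K M V E' A'" "inv_a K M V E A = inv_a K M V E' A'"
    "inv_s K M V E A = inv_s K M V E' A'"
proof -
  interpret S: linear_system K M V E A by fact
  interpret S': linear_system K M V E' A' by fact
  obtain P Q R where PQR: "g = (P, Q, R)" "P \<in> lin_autos K V" "Q \<in> lin_autos K M"
    "R \<in> lin_maps K M M"
    using g(1) unfolding weak_group_def by auto
  note P = lin_autosD[OF PQR(2)] and Q = lin_autosD[OF PQR(3)]
  note act = weak_action_apply[OF S.system g(2)[unfolded PQR(1)]]
  have R: "R x \<in> carrier M" if "x \<in> carrier M" for x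
    using PQR(4) module_hom_closed that unfolding lin_maps_def by blast
  interpret P: linear_map K V V P
    by (rule linear_mapI[OF S.V.vectorspace_axioms S.V.vectorspace_axioms P(1)])
  have P_iff: "P y \<in> P ` U \<longleftrightarrow> y \<in> U" if "y \<in> carrier V" "U \<subseteq> carrier V" for y U
    using inj_on_image_mem_iff[OF P(2) that] .
  have N: "x \<in> S'.kernel \<longleftrightarrow> Q x \<in> S.kernel" if x: "x \<in> carrier M" for x
    using P_iff[of "E (Q x)" "{\<zero>\<^bsub>V\<^esub>}"] act(1)[OF x] x Q(4)[OF x]
    unfolding S.kernel_def S'.kernel_def by simp
  \<comment> \<open>\<open>Q\<close> maps \<open>M\<close> onto itself, so the image of
    \<open>E'\<close> is the \<open>P\<close>-image of that of \<open>E\<close>.\<close>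
  have "codom1 M E' = (\<lambda>x. P (E x)) ` Q ` carrier M"
    unfolding codom1_def image_image using act(1) by (rule image_cong[OF refl])
  then have codom1: "codom1 M E' = P ` codom1 M E"
    unfolding Q(3) codom1_def image_image .
  have L: "x \<in> dom1 M E' A' \<longleftrightarrow> Q x \<in> dom1 M E A" if x: "x \<in> carrier M" for x
  proof -
    note D = S.V.subspaceD[OF S.codom1_subspace]
    let ?u = "E (R x)" and ?v = "A (Q x)"
    have u: "?u \<in> codom1 M E" unfolding codom1_def using R[OF x] by blast
    have uv: "?u \<in> carrier V" "?v \<in> carrier V" using R[OF x] Q(4)[OF x] by auto
    \<comment> \<open>Adding the element \<open>?u\<close> of \<open>V'\<close> does not affect
      membership in \<open>V'\<close>.\<close>
    have "?v = \<ominus>\<^bsub>V\<^esub> ?u \<oplus>\<^bsub>V\<^esub> (?u \<oplus>\<^bsub>V\<^esub> ?v)"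
      using uv by (simp add: S.V.a_assoc[symmetric] S.V.l_neg)
    then have "?u \<oplus>\<^bsub>V\<^esub> ?v \<in> codom1 M E \<longleftrightarrow> ?v \<in> codom1 M E"
      using D(3) D(5) u by metis
    then show ?thesis
      using P_iff[of "?u \<oplus>\<^bsub>V\<^esub> ?v" "codom1 M E"] uv D(1) x Q(4)[OF x] act(2)[OF x]
      unfolding dom1_def codom1 by simp
  qed
  note dim = S.M.dim_automorphism_vimage[OF S.M_fin_dim PQR(3)]
  have "vectorspace.dim K (M\<lparr>carrier := S'.kernel\<rparr>) = vectorspace.dim K (M\<lparr>carrier := S.kernel\<rparr>)"
    by (rule dim[OF S.kernel_subspace S'.kernel_subspace N])
  moreover have "vectorspace.dim K (M\<lparr>carrier := dom1 M E' A'\<rparr>)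
      = vectorspace.dim K (M\<lparr>carrier := dom1 M E A\<rparr>)"
    by (rule dim[OF S.dom1_subspace S'.dom1_subspace L])
  moreover have "vectorspace.dim K (M\<lparr>carrier := S'.kernel \<inter> dom1 M E' A'\<rparr>)
      = vectorspace.dim K (M\<lparr>carrier := S.kernel \<inter> dom1 M E A\<rparr>)"
    by (rule dim[OF S.M.subspace_Int[OF S.kernel_subspace S.dom1_subspace]
          S.M.subspace_Int[OF S'.kernel_subspace S'.dom1_subspace]]) (use N L in blast)
  ultimately show "inv_d K M V E A = inv_d K M V E' A'" "inv_a K M V E A = inv_a K M V E' A'"
    "inv_s K M V E A = inv_s K M V E' A'"
    using S.dim_d S.dim_a S.dim_s S'.dim_d S'.dim_a S'.dim_s by linarith+
qed

section \<open>Equal invariants give a common orbit\<close>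

lemma identity_lin_autos:
  assumes "vectorspace K V"
  shows "(\<lambda>x\<in>carrier V. x) \<in> lin_autos K V"
proof -
  interpret vectorspace K V by fact
  have "(\<lambda>x\<in>carrier V. x) \<in> module_hom K V V" by (rule module_homI) auto
  moreover have "(\<lambda>x\<in>carrier V. x) \<in> Bij (carrier V)"
    unfolding Bij_def bij_betw_def inj_on_def by auto
  ultimately show ?thesis unfolding lin_autos_def by blast
qed

text \<open>Both systems are reached from one base point \<open>(E, B)\<close>, where
  \<open>B\<close> is \<open>A\<close> with its part in the image of \<open>E\<close> split off.
  This is the form in which a common orbit is exhibited.\<close>

lemma orbit_of_equal_invariants:
  assumes S: "linear_system K M V E A" "linear_system K M V E' A'"
    and inv: "inv_d K M V E A = inv_d K M V E' A'" "inv_a K M V E A = inv_a K M V E' A'"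
      "inv_s K M V E A = inv_s K M V E' A'"
  obtains B g h where "(E, B) \<in> systems K M V" "g \<in> carrier (weak_group K M V)"
    "h \<in> carrier (weak_group K M V)" "weak_action K M V g (E, B) = (E, A)"
    "weak_action K M V h (E, B) = (E', A')"
proof -
  interpret S: linear_system K M V E A by fact
  interpret S': linear_system K M V E' A' by fact
  obtain R B where RB: "R \<in> lin_maps K M M" "(E, B) \<in> systems K M V"
    "\<forall>x\<in>carrier M. A x = E (R x) \<oplus>\<^bsub>V\<^esub> B x"
    "\<forall>x\<in>carrier M. B x \<in> codom1 M E \<longleftrightarrow> B x = \<zero>\<^bsub>V\<^esub>"
    "\<forall>x\<in>carrier M. B x = \<zero>\<^bsub>V\<^esub> \<longleftrightarrow> x \<in> dom1 M E A"
    by (rule S.split_off_image)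
  obtain R' B' where RB': "R' \<in> lin_maps K M M" "(E', B') \<in> systems K M V"
    "\<forall>x\<in>carrier M. A' x = E' (R' x) \<oplus>\<^bsub>V\<^esub> B' x"
    "\<forall>x\<in>carrier M. B' x \<in> codom1 M E' \<longleftrightarrow> B' x = \<zero>\<^bsub>V\<^esub>"
    "\<forall>x\<in>carrier M. B' x = \<zero>\<^bsub>V\<^esub> \<longleftrightarrow> x \<in> dom1 M E' A'"
    by (rule S'.split_off_image)
  have hom: "B \<in> module_hom K M V" "B' \<in> module_hom K M V"
    "R \<in> module_hom K M M" "R' \<in> module_hom K M M"
    using RB(1,2) RB'(1,2) unfolding systems_def lin_maps_def by auto
  \<comment> \<open>The formulas are solved in turn: \<open>s\<close> and \<open>d\<close> give the
    kernel, then \<open>a\<close> gives its intersection with \<open>M'\<close>, then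
    \<open>d\<close> gives \<open>M'\<close>.\<close>
  have "vectorspace.dim K (M\<lparr>carrier := S'.kernel\<rparr>) = vectorspace.dim K (M\<lparr>carrier := S.kernel\<rparr>)"
    using S.dim_s S'.dim_s inv by linarith
  moreover from this have "vectorspace.dim K (M\<lparr>carrier := S'.kernel \<inter> dom1 M E' A'\<rparr>)
      = vectorspace.dim K (M\<lparr>carrier := S.kernel \<inter> dom1 M E A\<rparr>)"
    using S.dim_a S'.dim_a inv by linarith
  moreover from this have "vectorspace.dim K (M\<lparr>carrier := dom1 M E' A'\<rparr>)
      = vectorspace.dim K (M\<lparr>carrier := dom1 M E A\<rparr>)"
    using S.dim_d S'.dim_d inv by linarith
  ultimately obtain Q where Q: "Q \<in> lin_autos K M"
    "\<And>x. x \<in> carrier M \<Longrightarrow> Q x \<in> S.kernel \<longleftrightarrow> x \<in> S'.kernel"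
    "\<And>x. x \<in> carrier M \<Longrightarrow> Q x \<in> dom1 M E A \<longleftrightarrow> x \<in> dom1 M E' A'"
    using S.M.automorphism_of_subspace_pairs[OF S.M_fin_dim S'.kernel_subspace S'.dom1_subspace
        S.kernel_subspace S.dom1_subspace] by metis
  note Qh = lin_autosD(1)[OF Q(1)] and QM = lin_autosD(4)[OF Q(1)]
  let ?W = "direct_sum M M"
  \<comment> \<open>The two arguments are independent, so one automorphism intertwining
    \<open>f\<close> and \<open>f'\<close> handles the \<open>E\<close> parts and the
    \<open>B\<close> parts at once.\<close>
  define f where "f p = E (Q (fst p)) \<oplus>\<^bsub>V\<^esub> B (Q (snd p))" for p
  define f' where "f' p = E' (fst p) \<oplus>\<^bsub>V\<^esub> B' (snd p)" for p
  have carW: "carrier ?W = carrier M \<times> carrier M" unfolding direct_sum_def by simp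
  have fh: "f \<in> module_hom K ?W V"
    unfolding f_def
    using direct_sum_hom[OF S.V.vectorspace_axioms module_hom_comp[OF Qh S.E_hom]
        module_hom_comp[OF Qh hom(1)]] .
  have fh': "f' \<in> module_hom K ?W V"
    unfolding f'_def using direct_sum_hom[OF S.V.vectorspace_axioms S'.E_hom hom(2)] .
  have BV: "B x \<in> carrier V" "B' x \<in> carrier V" if "x \<in> carrier M" for x
    using hom(1,2) that module_hom_closed by blast+
  \<comment> \<open>If the sum vanishes, \<open>v\<close> is the negative of \<open>u\<close> and
    hence in \<open>U\<close>. With \<open>U\<close> the image of \<open>E\<close>, this splits the
    kernel of \<open>f\<close> into a condition on each argument.\<close>
  have sum0: "u \<oplus>\<^bsub>V\<^esub> v = \<zero>\<^bsub>V\<^esub> \<longleftrightarrow> u = \<zero>\<^bsub>V\<^esub> \<and> v = \<zero>\<^bsub>V\<^esub>"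
    if U: "subspace K U V" and uv: "u \<in> U" "v \<in> carrier V" and v: "v \<in> U \<Longrightarrow> v = \<zero>\<^bsub>V\<^esub>" for U u v
  proof
    have uV: "u \<in> carrier V" using S.V.subspaceD(1)[OF U] uv(1) by blast
    assume 0: "u \<oplus>\<^bsub>V\<^esub> v = \<zero>\<^bsub>V\<^esub>"
    then have "v = \<ominus>\<^bsub>V\<^esub> u" using uV uv(2) S.V.minus_equality S.V.a_comm by metis
    then have "v \<in> U" using S.V.subspaceD(5)[OF U uv(1)] by simp
    then show "u = \<zero>\<^bsub>V\<^esub> \<and> v = \<zero>\<^bsub>V\<^esub>" using v 0 uV by simp
  qed simp
  have f0: "f p = \<zero>\<^bsub>V\<^esub> \<longleftrightarrow> f' p = \<zero>\<^bsub>V\<^esub>" if pW: "p \<in> carrier ?W" for p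
  proof -
    obtain x y where p: "p = (x, y)" and x: "x \<in> carrier M" and y: "y \<in> carrier M"
      using pW unfolding carW by blast
    have "f p = \<zero>\<^bsub>V\<^esub> \<longleftrightarrow> E (Q x) = \<zero>\<^bsub>V\<^esub> \<and> B (Q y) = \<zero>\<^bsub>V\<^esub>"
      unfolding f_def p fst_conv snd_conv
      by (rule sum0[OF S.codom1_subspace _ BV(1)[OF QM[OF y]] RB(4)[THEN bspec, OF QM[OF y], THEN iffD1]])
        (use QM[OF x] in \<open>auto simp: codom1_def\<close>)
    also have "\<dots> \<longleftrightarrow> E' x = \<zero>\<^bsub>V\<^esub> \<and> B' y = \<zero>\<^bsub>V\<^esub>"
      using Q(2)[OF x] Q(3)[OF y] RB(5)[THEN bspec, OF QM[OF y]] RB'(5)[THEN bspec, OF y] x QM[OF x]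
      unfolding S.kernel_def S'.kernel_def by simp
    also have "\<dots> \<longleftrightarrow> f' p = \<zero>\<^bsub>V\<^esub>"
      unfolding f'_def p fst_conv snd_conv
      by (rule sum0[symmetric, OF S'.codom1_subspace _ BV(2)[OF y] RB'(4)[THEN bspec, OF y, THEN iffD1]])
        (use x in \<open>auto simp: codom1_def\<close>)
    finally show ?thesis .
  qed
  obtain P where P: "P \<in> lin_autos K V" "\<And>p. p \<in> carrier ?W \<Longrightarrow> P (f p) = f' p"
    using S.V.automorphism_of_equal_kernels[OF S.V_fin_dim
        direct_sum_is_vs[OF S.M.vectorspace_axioms S.M.vectorspace_axioms] fh fh' f0] by metis
  have Pf: "P (E (Q x) \<oplus>\<^bsub>V\<^esub> B (Q y)) = E' x \<oplus>\<^bsub>V\<^esub> B' y"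
    if "x \<in> carrier M" "y \<in> carrier M" for x y
    using P(2)[of "(x, y)"] that unfolding carW f_def f'_def by simp
  \<comment> \<open>Setting the second argument of \<open>Pf\<close> to zero will isolate the
    equation for \<open>E'\<close>.\<close>
  have zero: "B \<zero>\<^bsub>M\<^esub> = \<zero>\<^bsub>V\<^esub>" "B' \<zero>\<^bsub>M\<^esub> = \<zero>\<^bsub>V\<^esub>" "Q \<zero>\<^bsub>M\<^esub> = \<zero>\<^bsub>M\<^esub>"
    using linear_mapI[OF S.M.vectorspace_axioms S.V.vectorspace_axioms hom(1)]
      linear_mapI[OF S.M.vectorspace_axioms S.V.vectorspace_axioms hom(2)]
      linear_mapI[OF S.M.vectorspace_axioms S.M.vectorspace_axioms Qh]
    by (simp_all add: linear_map.T0_is_0)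
  \<comment> \<open>Putting \<open>R' x\<close> for the first argument of \<open>Pf\<close> turns
    \<open>E' (R' x)\<close> into the image under \<open>P\<close> of \<open>E (Q (R' x))\<close>,
    which dictates this witness.\<close>
  let ?R = "\<lambda>x\<in>carrier M. Q (R' x)"
  have R: "R x \<in> carrier M" "R' x \<in> carrier M" if "x \<in> carrier M" for x
    using hom(3,4) that module_hom_closed by blast+
  show ?thesis
  proof (rule that[OF RB(2)])
    show "((\<lambda>x\<in>carrier V. x), (\<lambda>x\<in>carrier M. x), R) \<in> carrier (weak_group K M V)"
      unfolding weak_group_def
      using identity_lin_autos[OF S.M.vectorspace_axioms] identity_lin_autos[OF S.V.vectorspace_axioms]
        RB(1) by simp
    have "?R \<in> module_hom K M M"
      by (rule module_hom_cong[OF S.M.module_axioms module_hom_comp[OF hom(4) Qh]]) simp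
    then show "(P, Q, ?R) \<in> carrier (weak_group K M V)"
      unfolding weak_group_def lin_maps_def using P(1) Q(1) by simp
    show "weak_action K M V ((\<lambda>x\<in>carrier V. x), (\<lambda>x\<in>carrier M. x), R) (E, B) = (E, A)"
      by (rule weak_action_eqI[OF RB(2) S.system]) (use RB(3) R BV in auto)
    show "weak_action K M V (P, Q, ?R) (E, B) = (E', A')"
    proof (rule weak_action_eqI[OF RB(2) S'.system])
      fix x assume x: "x \<in> carrier M"
      show "E' x = P (E (Q x))"
        using Pf[OF x S.M.zero_closed] x QM[OF x] by (simp add: zero)
      show "A' x = P (E (?R x) \<oplus>\<^bsub>V\<^esub> B (Q x))"
        using Pf[OF R(2)[OF x] x] RB'(3)[THEN bspec, OF x] x by simp
    qed
  qed
qed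

theorem theorem5p1:
  fixes K :: "('k, 'c) ring_scheme"
    and M :: "('k, 'm, 'd) module_scheme"
    and V :: "('k, 'v, 'e) module_scheme"
    and E A E' A' :: "'m \<Rightarrow> 'v"
  assumes "vectorspace K M" and "vectorspace.fin_dim K M"
    and "vectorspace K V" and "vectorspace.fin_dim K V"
    and "(E, A) \<in> systems K M V" and "(E', A') \<in> systems K M V"
  shows "(\<exists>X \<in> orbits (weak_group K M V) (systems K M V) (weak_action K M V).
            (E, A) \<in> X \<and> (E', A') \<in> X)
      \<longleftrightarrow> inv_d K M V E A = inv_d K M V E' A'
        \<and> inv_a K M V E A = inv_a K M V E' A'
        \<and> inv_s K M V E A = inv_s K M V E' A'"
proof
  have sys: "linear_system K M V F B" if "(F, B) \<in> systems K M V" for F B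
    using assms(1-4) that by (simp add: linear_system_def linear_system_axioms_def)
  {
    assume "\<exists>X \<in> orbits (weak_group K M V) (systems K M V) (weak_action K M V).
            (E, A) \<in> X \<and> (E', A') \<in> X"
    \<comment> \<open>Members of one orbit are images of a common base point, through which their
      invariants are compared.\<close>
    then obtain F B g h where FB: "(F, B) \<in> systems K M V"
      and g: "g \<in> carrier (weak_group K M V)" "weak_action K M V g (F, B) = (E, A)"
      and h: "h \<in> carrier (weak_group K M V)" "weak_action K M V h (F, B) = (E', A')"
      unfolding orbits_def orbit_def by fastforce
    show "inv_d K M V E A = inv_d K M V E' A' \<and> inv_a K M V E A = inv_a K M V E' A'
        \<and> inv_s K M V E A = inv_s K M V E' A'"
      using invariants_weak_action[OF sys[OF FB] sys[OF assms(5)] g]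
        invariants_weak_action[OF sys[OF FB] sys[OF assms(6)] h] by simp
  next
    assume "inv_d K M V E A = inv_d K M V E' A' \<and> inv_a K M V E A = inv_a K M V E' A'
        \<and> inv_s K M V E A = inv_s K M V E' A'"
    then obtain B g h where B: "(E, B) \<in> systems K M V"
      and gh: "g \<in> carrier (weak_group K M V)" "h \<in> carrier (weak_group K M V)"
        "weak_action K M V g (E, B) = (E, A)" "weak_action K M V h (E, B) = (E', A')"
      using orbit_of_equal_invariants[OF sys[OF assms(5)] sys[OF assms(6)]] by metis
    let ?X = "orbit (weak_group K M V) (weak_action K M V) (E, B)"
    have "?X \<in> orbits (weak_group K M V) (systems K M V) (weak_action K M V)"
      unfolding orbits_def using B by blast
    moreover have "(E, A) \<in> ?X" "(E', A') \<in> ?X"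
      unfolding orbit_def using gh(1,2) gh(3,4)[symmetric] by blast+
    ultimately show "\<exists>X \<in> orbits (weak_group K M V) (systems K M V) (weak_action K M V).
            (E, A) \<in> X \<and> (E', A') \<in> X" by blast
  }
qed

end
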